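(* Let $G$ be a finite graph (loops and multiple edges allowed) with a fixed orientation, $\mathbb{F}$ a field and $\boldsymbol b\in B(G,\mathbb{F})$. Then: (a) If $E_{\rm cut}^{\boldsymbol b}(G)=\emptyset$, then $\chi(\mathcal{A}_{E(G)}^{\boldsymbol b},t)=\chi(\tilde{\mathcal{A}}_{E(G)}^{\boldsymbol b},t)$ is a polynomial of degree $n(G)$ with leading coefficient $1$; otherwise $\chi(\mathcal{A}_{E(G)}^{\boldsymbol b},t)$ vanishes identically. (b) $\chi(\mathcal{A}_{E(G)}^{\boldsymbol b},t)=\varphi_G(\alpha,t)=\varphi_G(\Pi_{\boldsymbol b},t)$ with $\alpha=\alpha_{G,\boldsymbol b}$, where $\Pi_{\boldsymbol b}=\{\pi\in\Pi(G):\boldsymbol b\in B_\pi\}$. In particular, $\varphi_G(\Pi_{\boldsymbol 0},t)$ is the flow polynomial $\varphi_G(t)$. (c) If $\mathbb{F}=\mathbb{F}_q$ is a finite field of $q$ elements, then $$\chi(\mathcal{A}_{E(G)}^{\boldsymbol b},q)=|M(\mathcal{A}_{E(G)}^{\boldsymbol b})|=|F_{\rm nz}(G,\boldsymbol b;\mathbb{F}_q)|=\varphi_G(\Pi_{\boldsymbol b},q).$$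
   Context: Graph notation. For $S\subseteq E(G)$: $S^c=E(G)\smallsetminus S$; $c(S)$ is the number of components of $(V(G),S)$; $r(S)=|V(G)|-c(S)$; $n(S)=|S|-r(S)$; $c(G)=c(E(G))$, $n(G)=n(E(G))$. $\pi(S)$ is the partition of $V(G)$ into vertex sets of components of $(V(G),S)$; $\Pi(G)=\{\pi(S):S\subseteq E(G)\}$. $E_{\rm cut}(G)$ is the set of cut-edges (edges contained in no cycle; loops are cycles). $G\setminus S$ is $G$ with the edges of $S$ deleted (same vertex set, inherited orientation); $G[X]$ is the subgraph induced by $X\subseteq V(G)$. Flow polynomials. The flow polynomial is $\varphi_G(t)=\sum_{S\subseteq E(G)}(-1)^{|S^c|}t^{n(S)}$; for $\mathfrak{p}\subseteq\Pi(G)$, $\varphi_G(\mathfrak{p},t)=\sum_{S\subseteq E(G),\,\pi(S)\in\mathfrak{p}}(-1)^{|S^c|}t^{n(S)}$. Affine flows. The boundary operator $\partial:\mathbb{F}^{E(G)}\to\mathbb{F}^{V(G)}$ is $\partial\boldsymbol c(v)=\sum_{e\in E^+(v)}\boldsymbol c(e)-\sum_{e\in E^-(v)}\boldsymbol c(e)$, where $E^+(v)$ (resp. $E^-(v)$) is the set of edges with head (resp. tail) $v$ (loops contribute $0$). $B(G,\mathbb{F})=\partial(\mathbb{F}^{E(G)})$. $F(G,\boldsymbol b;\mathbb{F})=\{\boldsymbol c\in\mathbb{F}^{E(G)}:\partial\boldsymbol c=\boldsymbol b\}$ and $F_{\rm nz}(G,\boldsymbol b;\mathbb{F})$ is the set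 of $\boldsymbol c\in F(G,\boldsymbol b;\mathbb{F})$ with $\boldsymbol c(e)\neq0$ for all $e\in E(G)$. For $\pi\in\Pi(G)$, $B_\pi=\{\boldsymbol x\in\mathbb{F}^{V(G)}:\sum_{v\in U}\boldsymbol x(v)=0\text{ for every block }U\in\pi\}$. $E_{\rm cut}^{\boldsymbol b}(G)=\{e\in E_{\rm cut}(G):\boldsymbol b\in B(G\setminus e,\mathbb{F})\}$. Arrangements. For a finite set $\mathcal{A}$ of affine subspaces of an affine space $V$ over $\mathbb{F}$ (where $V\in\mathcal{A}$ is allowed), $\chi(\mathcal{A},t)=\sum_{\mathcal{B}\subseteq\mathcal{A},\,\bigcap_{H\in\mathcal{B}}H\neq\emptyset}(-1)^{|\mathcal{B}|}t^{\dim\bigcap_{H\in\mathcal{B}}H}$ (the empty intersection is $V$), and $M(\mathcal{A})=V\smallsetminus\bigcup_{H\in\mathcal{A}}H$. Let $H_e=\{\boldsymbol x\in\mathbb{F}^{E(G)}:\boldsymbol x(e)=0\}$ and $H_e^{\boldsymbol b}=H_e\cap F(G,\boldsymbol b;\mathbb{F})$. $\mathcal{A}_{E(G)}^{\boldsymbol b}=\{H_e^{\boldsymbol b}:e\in E(G),H_e^{\boldsymbol b}\neq\emptyset\}$, an arrangement in $F(G,\boldsymbol b;\mathbb{F})$ (possibly containing the whole space), and $\tilde{\mathcal{A}}_{E(G)}^{\boldsymbol b}=\mathcal{A}_{E(G)}^{\boldsymbol b}\smallsetminus\{F(G,\boldsymbol b;\mathbb{F})\}$. Assigning polynomial. Let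 $\Lambda(G)$ be the family of nonempty $X\subseteq V(G)$ with $G[X]$ connected and $c(G[V(G)\smallsetminus X])=c(G)$. A function $\boldsymbol b$ on $V(G)$ induces $\alpha_{G,\boldsymbol b}:\Lambda(G)\to\{0,1\}$ with $\alpha_{G,\boldsymbol b}(X)=0$ iff $\sum_{v\in X}\boldsymbol b(v)=0$. For $\boldsymbol b\in B(G,\mathbb{F})$ and $\alpha=\alpha_{G,\boldsymbol b}$, the assigning polynomial is $\varphi_G(\alpha,t)=\sum(-1)^{|S|}t^{n(S^c)}$, summed over all $S\subseteq E(G)$ such that $G\setminus S$ is $\boldsymbol b$-compatible, i.e. $\sum_{v}\boldsymbol b(v)=0$ over the vertices of each component of $G\setminus S$. *)

theory Defs
  imports
    "Graph_Theory.Digraph_Component"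
    "HOL-Computational_Algebra.Polynomial"
    "HOL-Library.Function_Algebras"
    "HOL-Library.FuncSet"
begin

text \<open>
  A finite oriented multigraph is a \<^locale>\<open>fin_digraph\<close>: the orientation of an edge is
  given by its tail and head, and loops and parallel edges are allowed. All graph notions
  below except the boundary operator refer to the underlying undirected graph.
\<close>

section \<open>Graphs\<close>

definition spanning_subgraph :: "('v, 'e) pre_digraph \<Rightarrow> 'e set \<Rightarrow> ('v, 'e) pre_digraph" where
  "spanning_subgraph G S = G\<lparr>arcs := S\<rparr>"

definition del_arcs :: "('v, 'e) pre_digraph \<Rightarrow> 'e set \<Rightarrow> ('v, 'e) pre_digraph" where
  "del_arcs G S = G\<lparr>arcs := arcs G - S\<rparr>"

text \<open>The components of a graph are the strong components of its symmetric closure.\<close>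

definition component_verts :: "('v, 'e) pre_digraph \<Rightarrow> 'v set set" where
  "component_verts G = pre_digraph.sccs_verts (with_proj (mk_symmetric G))"

definition num_components :: "('v, 'e) pre_digraph \<Rightarrow> nat" where
  "num_components G = card (component_verts G)"

definition edge_partition :: "('v, 'e) pre_digraph \<Rightarrow> 'e set \<Rightarrow> 'v set set" where
  "edge_partition G S = component_verts (spanning_subgraph G S)"

definition partitions :: "('v, 'e) pre_digraph \<Rightarrow> 'v set set set" where
  "partitions G = edge_partition G ` Pow (arcs G)"

text \<open>
  The subtractions are on natural numbers; they do not truncate, since
  \<open>c(S) \<le> |V(G)|\<close> and \<open>r(S) \<le> |S|\<close>.
\<close>

definition edge_rank :: "('v, 'e) pre_digraph \<Rightarrow> 'e set \<Rightarrow> nat" where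
  "edge_rank G S = card (verts G) - num_components (spanning_subgraph G S)"

definition nullity :: "('v, 'e) pre_digraph \<Rightarrow> 'e set \<Rightarrow> nat" where
  "nullity G S = card S - edge_rank G S"

text \<open>
  A cycle is given by its cyclically ordered distinct vertices and distinct edges. Edge
  orientation is ignored; length 1 gives the loops, length 2 the pairs of parallel edges.
\<close>

definition undirected_cycle :: "('v, 'e) pre_digraph \<Rightarrow> 'v list \<Rightarrow> 'e list \<Rightarrow> bool" where
  "undirected_cycle G vs es \<longleftrightarrow>
     vs \<noteq> [] \<and> length es = length vs \<and> distinct vs \<and> distinct es \<and> set es \<subseteq> arcs G \<and>
     (\<forall>i<length vs. {tail G (es ! i), head G (es ! i)} = {vs ! i, vs ! (Suc i mod length vs)})"

definition cut_edges :: "('v, 'e) pre_digraph \<Rightarrow> 'e set" where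
  "cut_edges G = {e \<in> arcs G. \<not> (\<exists>vs es. undirected_cycle G vs es \<and> e \<in> set es)}"

section \<open>Flow polynomials\<close>

definition flow_poly :: "('v, 'e) pre_digraph \<Rightarrow> int poly" where
  "flow_poly G = (\<Sum>S \<in> Pow (arcs G). monom ((-1) ^ card (arcs G - S)) (nullity G S))"

definition partition_flow_poly :: "('v, 'e) pre_digraph \<Rightarrow> 'v set set set \<Rightarrow> int poly" where
  "partition_flow_poly G P =
     (\<Sum>S | S \<subseteq> arcs G \<and> edge_partition G S \<in> P.
        monom ((-1) ^ card (arcs G - S)) (nullity G S))"

section \<open>Affine flows\<close>

text \<open>
  \<open>F\<^sup>I\<close> is rendered as the space of all functions into the field \<open>'f\<close> that vanish outside \<open>I\<close>.
\<close>

definition coord_space :: "'i set \<Rightarrow> ('i \<Rightarrow> 'f::field) set" where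
  "coord_space I = {x. \<forall>i. i \<notin> I \<longrightarrow> x i = 0}"

definition boundary :: "('v, 'e) pre_digraph \<Rightarrow> ('e \<Rightarrow> 'f::field) \<Rightarrow> 'v \<Rightarrow> 'f" where
  "boundary G c v = (\<Sum>e \<in> in_arcs G v. c e) - (\<Sum>e \<in> out_arcs G v. c e)"

definition boundaries :: "('v, 'e) pre_digraph \<Rightarrow> ('v \<Rightarrow> 'f::field) set" where
  "boundaries G = boundary G ` coord_space (arcs G)"

definition flows :: "('v, 'e) pre_digraph \<Rightarrow> ('v \<Rightarrow> 'f::field) \<Rightarrow> ('e \<Rightarrow> 'f) set" where
  "flows G b = {c \<in> coord_space (arcs G). boundary G c = b}"

definition nz_flows :: "('v, 'e) pre_digraph \<Rightarrow> ('v \<Rightarrow> 'f::field) \<Rightarrow> ('e \<Rightarrow> 'f) set" where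
  "nz_flows G b = {c \<in> flows G b. \<forall>e \<in> arcs G. c e \<noteq> 0}"

definition block_zero :: "('v, 'e) pre_digraph \<Rightarrow> 'v set set \<Rightarrow> ('v \<Rightarrow> 'f::field) set" where
  "block_zero G P = {x \<in> coord_space (verts G). \<forall>U \<in> P. (\<Sum>v \<in> U. x v) = 0}"

definition partitions_of :: "('v, 'e) pre_digraph \<Rightarrow> ('v \<Rightarrow> 'f::field) \<Rightarrow> 'v set set set" where
  "partitions_of G b = {P \<in> partitions G. b \<in> block_zero G P}"

definition cut_edges_of :: "('v, 'e) pre_digraph \<Rightarrow> ('v \<Rightarrow> 'f::field) \<Rightarrow> 'e set" where
  "cut_edges_of G b = {e \<in> cut_edges G. b \<in> boundaries (del_arcs G {e})}"

section \<open>Arrangements of affine subspaces\<close>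

definition fun_scale :: "'f::field \<Rightarrow> ('i \<Rightarrow> 'f) \<Rightarrow> 'i \<Rightarrow> 'f" where
  "fun_scale a x = (\<lambda>i. a * x i)"

interpretation fun_space: vector_space fun_scale
  by unfold_locales (auto simp: fun_scale_def fun_eq_iff algebra_simps)

text \<open>The dimension of a nonempty affine subspace is the dimension of its space of directions.\<close>

definition affine_dim :: "('i \<Rightarrow> 'f::field) set \<Rightarrow> nat" where
  "affine_dim A = fun_space.dim {x - y |x y. x \<in> A \<and> y \<in> A}"

text \<open>Intersecting with the ambient space \<open>V\<close> makes the empty intersection equal to \<open>V\<close>.\<close>

definition arr_char_poly :: "('i \<Rightarrow> 'f::field) set \<Rightarrow> ('i \<Rightarrow> 'f) set set \<Rightarrow> int poly" where
  "arr_char_poly V \<A> =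
     (\<Sum>\<B> | \<B> \<subseteq> \<A> \<and> V \<inter> \<Inter>\<B> \<noteq> {}. monom ((-1) ^ card \<B>) (affine_dim (V \<inter> \<Inter>\<B>)))"

definition arr_complement :: "('i \<Rightarrow> 'f::field) set \<Rightarrow> ('i \<Rightarrow> 'f) set set \<Rightarrow> ('i \<Rightarrow> 'f) set" where
  "arr_complement V \<A> = V - \<Union>\<A>"

definition edge_hyperplane :: "('v, 'e) pre_digraph \<Rightarrow> 'e \<Rightarrow> ('e \<Rightarrow> 'f::field) set" where
  "edge_hyperplane G e = {x \<in> coord_space (arcs G). x e = 0}"

definition flow_arr :: "('v, 'e) pre_digraph \<Rightarrow> ('v \<Rightarrow> 'f::field) \<Rightarrow> ('e \<Rightarrow> 'f) set set" where
  "flow_arr G b =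
     {edge_hyperplane G e \<inter> flows G b |e. e \<in> arcs G \<and> edge_hyperplane G e \<inter> flows G b \<noteq> {}}"

definition flow_arr_proper :: "('v, 'e) pre_digraph \<Rightarrow> ('v \<Rightarrow> 'f::field) \<Rightarrow> ('e \<Rightarrow> 'f) set set"
  where
  "flow_arr_proper G b = flow_arr G b - {flows G b}"

section \<open>Assigning polynomials\<close>

definition Lambda :: "('v, 'e) pre_digraph \<Rightarrow> 'v set set" where
  "Lambda G = {X. X \<noteq> {} \<and> X \<subseteq> verts G \<and> Digraph_Component.connected (G \<restriction> X) \<and>
     num_components (G \<restriction> (verts G - X)) = num_components G}"

definition assigning :: "('v, 'e) pre_digraph \<Rightarrow> ('v \<Rightarrow> 'f::field) \<Rightarrow> 'v set \<Rightarrow> nat" where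
  "assigning G b = (\<lambda>X \<in> Lambda G. if (\<Sum>v \<in> X. b v) = 0 then 0 else 1)"

definition b_compatible :: "('v \<Rightarrow> 'f::field) \<Rightarrow> ('v, 'e) pre_digraph \<Rightarrow> bool" where
  "b_compatible b H \<longleftrightarrow> (\<forall>U \<in> component_verts H. (\<Sum>v \<in> U. b v) = 0)"

text \<open>
  The assigning polynomial is a function of \<open>\<alpha>\<close>, specified through a representation
  \<open>\<alpha> = \<alpha>\<^bsub>G,b\<^esub>\<close> with \<open>b\<close> a boundary over the field \<open>'f\<close>. For finite \<open>G\<close> it does not depend on
  the chosen \<open>b\<close>: if \<open>X\<close> is a component of \<open>G - S\<close> inside the component \<open>C\<close> of \<open>G\<close>, then the
  components of \<open>G[C - X]\<close> are unions of components of \<open>G - S\<close> and belong to \<open>\<Lambda>(G)\<close>, and \<open>b\<close>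
  sums to zero over \<open>C\<close>; so whether \<open>G - S\<close> is \<open>b\<close>-compatible is determined by \<open>\<alpha>\<close>.
\<close>

definition assigning_poly ::
  "'f::field itself \<Rightarrow> ('v, 'e) pre_digraph \<Rightarrow> ('v set \<Rightarrow> nat) \<Rightarrow> int poly" where
  "assigning_poly F G \<alpha> =
     (THE p. \<exists>b :: 'v \<Rightarrow> 'f. b \<in> boundaries G \<and> \<alpha> = assigning G b \<and>
        p = (\<Sum>S | S \<subseteq> arcs G \<and> b_compatible b (del_arcs G S).
               monom ((-1) ^ card S) (nullity G (arcs G - S))))"

end

theory Submission
  imports Defs
begin

text \<open>
  All the polynomials in the theorem are the same alternating sum over the edge sets \<open>S\<close>. The
  \<open>S\<close>-term is \<open>(-1)\<^bsup>|S|\<^esup> t\<^bsup>n(E - S)\<^esup>\<close> if the flow equation \<open>\<partial>c = b\<close> has a solution supported on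
  \<open>E - S\<close>, and zero otherwise. Two facts of linear algebra make this work, and both are
  proved by adding edges one at a time. The equation is solvable on \<open>S\<close> exactly when \<open>b\<close> sums to
  zero over every component of \<open>(V, S)\<close> (\<open>flows_on_nonempty_iff\<close>). The circulations on \<open>S\<close> form a
  space of dimension \<open>n(S)\<close> (\<open>circulations_basis\<close>, and \<open>card_flows_on\<close> for its number of elements
  over a finite field): an edge joining two components adds no circulation, an edge
  within a component adds exactly one up to scaling and smaller circulations.

  The characteristic polynomial becomes this sum because
  different edges with the same hyperplane, and edges with an empty hyperplane, may be counted
  separately without changing an alternating sum (\<open>alternating_sum_image\<close>,
  \<open>char_poly_expansion\<close>). For the partition flow polynomial it is a rewriting of the
  definition. For the assigning polynomial the same holds once it is known that the
  assigning \<open>\<alpha>\<close> determines which edge sets are compatible (\<open>compatible_transfer\<close>).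

  For part (a), an edge \<open>e\<close> is a cut edge iff its ends are not joined in \<open>E - e\<close>
  (\<open>cut_edges_iff\<close>). A cut edge that every flow avoids can be put into or taken out of \<open>S\<close>
  without changing the term except in sign, so the sum cancels in pairs; without such
  edges the nullity drops as soon as \<open>S\<close> is nonempty, so the term of the empty set
  leads. Part (c) is inclusion-exclusion: at \<open>t = q\<close> the power \<open>q\<^bsup>n(E - S)\<^esup>\<close> counts the flows that
  vanish on \<open>S\<close>.
\<close>

section \<open>Components of edge sets\<close>

definition edge_rel :: "('v, 'e) pre_digraph \<Rightarrow> 'e set \<Rightarrow> ('v \<times> 'v) set" where
  "edge_rel G S = (\<Union>e\<in>S. {(tail G e, head G e), (head G e, tail G e)})"

text \<open>
  This set is meaningful for every edge set \<open>S\<close> of the fixed graph, so that induction on \<open>S\<close>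
  never has to change the graph.
\<close>

definition component :: "('v, 'e) pre_digraph \<Rightarrow> 'e set \<Rightarrow> 'v \<Rightarrow> 'v set" where
  "component G S v = (edge_rel G S)\<^sup>* `` {v}"

lemma edge_rel_sym: "(u, v) \<in> edge_rel G S \<Longrightarrow> (v, u) \<in> edge_rel G S"
  by (auto simp: edge_rel_def)

lemma component_refl [simp]: "v \<in> component G S v"
  by (simp add: component_def)

lemma component_sym: "u \<in> component G S v \<Longrightarrow> v \<in> component G S u"
  unfolding component_def
  by (metis Image_singleton_iff edge_rel_sym sym_def sym_rtrancl symD)

lemma component_trans: "w \<in> component G S u \<Longrightarrow> u \<in> component G S v \<Longrightarrow> w \<in> component G S v"
  by (auto simp: component_def)

lemma component_eq: "u \<in> component G S v \<Longrightarrow> component G S u = component G S v"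
  by (blast intro: component_sym component_trans)

lemma component_disjoint: "component G S u \<noteq> component G S v \<Longrightarrow> component G S u \<inter> component G S v = {}"
  by (auto dest: component_eq)

lemma component_step: "(u, w) \<in> edge_rel G S \<Longrightarrow> u \<in> component G S v \<longleftrightarrow> w \<in> component G S v"
  unfolding component_def using edge_rel_sym by (metis Image_singleton_iff rtrancl.simps)

lemma component_edge: "e \<in> S \<Longrightarrow> head G e \<in> component G S v \<longleftrightarrow> tail G e \<in> component G S v"
  by (rule component_step) (auto simp: edge_rel_def)

lemma component_mono: "S \<subseteq> T \<Longrightarrow> component G S v \<subseteq> component G T v"
  unfolding component_def by (intro Image_mono rtrancl_mono) (auto simp: edge_rel_def)

lemma component_empty [simp]: "component G {} v = {v}"
  by (auto simp: component_def edge_rel_def)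

lemma component_subsetI:
  assumes "v \<in> W" and "\<And>u w. u \<in> W \<Longrightarrow> (u, w) \<in> edge_rel G S \<Longrightarrow> w \<in> W"
  shows "component G S v \<subseteq> W"
proof
  fix u assume "u \<in> component G S v"
  then have "(v, u) \<in> (edge_rel G S)\<^sup>*" by (simp add: component_def)
  then show "u \<in> W" by induct (use assms in auto)
qed

text \<open>
  The steps between vertices of a component use only edges with both ends in it.
\<close>

lemma component_within:
  assumes "component G S v \<subseteq> W" "\<And>e. e \<in> S \<Longrightarrow> tail G e \<in> W \<Longrightarrow> head G e \<in> W \<Longrightarrow> e \<in> T"
  shows "component G S v \<subseteq> component G T v"
proof -
  have "component G S v \<subseteq> component G T v \<inter> component G S v"
  proof (rule component_subsetI)
    fix u w assume u: "u \<in> component G T v \<inter> component G S v" and uw: "(u, w) \<in> edge_rel G S"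
    then have w: "w \<in> component G S v" using component_step by (metis IntD2)
    obtain e where e: "e \<in> S" "u = tail G e \<and> w = head G e \<or> u = head G e \<and> w = tail G e"
      using uw by (auto simp: edge_rel_def)
    then have "e \<in> T" using u w assms by blast
    then have "(u, w) \<in> edge_rel G T" using e(2) by (auto simp: edge_rel_def)
    then show "w \<in> component G T v \<inter> component G S v" using u w component_step by (metis IntD1 IntI)
  qed simp
  then show ?thesis by blast
qed

lemma sum_components:
  assumes "finite Y" "\<And>u. u \<in> Y \<Longrightarrow> component G S u \<subseteq> Y"
  shows "sum b Y = (\<Sum>U\<in>component G S ` Y. sum b U)"
proof -
  have "Y = \<Union> (component G S ` Y)" using assms(2) component_refl by fastforce
  moreover have "sum b (\<Union> (component G S ` Y)) = (sum \<circ> sum) b (component G S ` Y)"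
  proof (rule sum.Union_disjoint)
    show "\<forall>A\<in>component G S ` Y. finite A"
      using assms(2) by (auto intro: finite_subset[OF _ assms(1)])
    show "\<forall>A\<in>component G S ` Y. \<forall>B\<in>component G S ` Y. A \<noteq> B \<longrightarrow> A \<inter> B = {}"
      using component_disjoint[of G S] by auto
  qed
  ultimately show ?thesis by simp
qed

lemma component_insert:
  "component G (insert e S) v =
     (if tail G e \<in> component G S v \<or> head G e \<in> component G S v
      then component G S (tail G e) \<union> component G S (head G e) else component G S v)"
proof (cases "tail G e \<in> component G S v \<or> head G e \<in> component G S v")
  case True
  have "component G (insert e S) v \<subseteq> component G S (tail G e) \<union> component G S (head G e)"
  proof (rule component_subsetI)
    show "v \<in> component G S (tail G e) \<union> component G S (head G e)" using True by (auto intro: component_sym)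
  next
    fix u w assume "u \<in> component G S (tail G e) \<union> component G S (head G e)"
      and "(u, w) \<in> edge_rel G (insert e S)"
    then show "w \<in> component G S (tail G e) \<union> component G S (head G e)"
      using component_step[of u w G S] by (auto simp: edge_rel_def)
  qed
  moreover have "component G S (tail G e) \<union> component G S (head G e) \<subseteq> component G (insert e S) v"
    using True component_mono[of S "insert e S" G] component_edge[of e "insert e S" G v]
    by (blast intro: component_trans)
  ultimately show ?thesis using True by auto
next
  case False
  have "component G (insert e S) v \<subseteq> component G S v"
    by (rule component_subsetI) (use False component_step[of _ _ G S v] in \<open>auto simp: edge_rel_def\<close>)
  then show ?thesis using False component_mono[of S "insert e S" G v] by auto
qed

lemma component_insert_joined:
  assumes "head G e \<in> component G S (tail G e)"
  shows "component G (insert e S) v = component G S v"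
proof -
  have same: "component G S (head G e) = component G S (tail G e)" using assms by (rule component_eq)
  show ?thesis
  proof (cases "tail G e \<in> component G S v")
    case True
    then show ?thesis using component_eq[OF True] same by (simp add: component_insert)
  next
    case False
    moreover have "head G e \<notin> component G S v"
      using False assms by (blast intro: component_sym component_trans)
    ultimately show ?thesis by (simp add: component_insert)
  qed
qed

lemma component_insert_touching:
  "v \<in> component G S (tail G e) \<union> component G S (head G e) \<Longrightarrow>
   component G (insert e S) v = component G S (tail G e) \<union> component G S (head G e)"
  by (auto simp: component_insert dest: component_sym)

lemma component_insert_apart:
  "v \<notin> component G S (tail G e) \<union> component G S (head G e) \<Longrightarrow> component G (insert e S) v = component G S v"
  by (auto simp: component_insert dest: component_sym)

lemma reachable_mk_symmetric_comp:
  assumes "wf_digraph H"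
  shows "reachable (with_proj (mk_symmetric H)) u v \<longleftrightarrow>
    u \<in> verts H \<and> v \<in> component H (arcs H) u"
proof -
  interpret wf_digraph H by fact
  interpret P: pair_wf_digraph "mk_symmetric H" by (rule wellformed_mk_symmetric)
  have "parcs (mk_symmetric H) = edge_rel H (arcs H)"
    by (simp add: parcs_mk_symmetric edge_rel_def)
  then have "reachable (with_proj (mk_symmetric H)) u v \<longleftrightarrow> v \<in> component H (arcs H) u"
    if "u \<in> verts H"
    using P.reachable_conv'[of u v] that
    by (simp add: component_def )
  moreover have "u \<in> verts H" if "reachable (with_proj (mk_symmetric H)) u v"
    using P.reachable_in_verts(1)[OF that] by simp
  ultimately show ?thesis by blast
qed

text \<open>
  In the symmetric closure reachability is an equivalence, so strong components are
  classes of the relation generated by the edges.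
\<close>

lemma component_verts_comp:
  assumes "wf_digraph H"
  shows "component_verts H = component H (arcs H) ` verts H"
proof -
  interpret wf_digraph H by fact
  interpret P: pair_wf_digraph "mk_symmetric H" by (rule wellformed_mk_symmetric)
  have "P.scc_of u = component H (arcs H) u" if u: "u \<in> verts H" for u
  proof (intro set_eqI iffI)
    fix v assume "v \<in> P.scc_of u"
    then have "reachable (with_proj (mk_symmetric H)) u v" by (simp add: P.scc_of_def)
    then show "v \<in> component H (arcs H) u" by (simp only: reachable_mk_symmetric_comp[OF assms])
  next
    fix v assume v: "v \<in> component H (arcs H) u"
    then have uv: "reachable (with_proj (mk_symmetric H)) u v"
      using u by (simp only: reachable_mk_symmetric_comp[OF assms])
    then have "v \<in> verts H" using P.reachable_in_verts(2) by fastforce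
    then have "reachable (with_proj (mk_symmetric H)) v u"
      using component_sym[OF v] by (simp only: reachable_mk_symmetric_comp[OF assms])
    then show "v \<in> P.scc_of u" using uv by (simp add: P.scc_of_def)
  qed
  then show ?thesis
    unfolding component_verts_def P.sccs_verts_conv_scc_of
    by (simp only: with_proj_simps pverts_mk_symmetric cong: image_cong)
qed

lemma component_cong: "tail H = tail G \<Longrightarrow> head H = head G \<Longrightarrow> component H S = component G S"
  by (auto simp: component_def edge_rel_def fun_eq_iff)

context fin_digraph
begin

lemma finite_edges: "S \<subseteq> arcs G \<Longrightarrow> finite S"
  by (erule finite_subset) (rule finite_arcs)

lemma component_subset_verts: "S \<subseteq> arcs G \<Longrightarrow> v \<in> verts G \<Longrightarrow> component G S v \<subseteq> verts G"
  by (rule component_subsetI) (auto simp: edge_rel_def)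

lemma finite_comp: "S \<subseteq> arcs G \<Longrightarrow> v \<in> verts G \<Longrightarrow> finite (component G S v)"
  by (rule finite_subset[OF component_subset_verts finite_verts])

lemma component_verts_spanning:
  assumes "S \<subseteq> arcs G"
  shows "component_verts (spanning_subgraph G S) = component G S ` verts G"
proof -
  have "wf_digraph (spanning_subgraph G S)"
    using assms by unfold_locales (auto simp: spanning_subgraph_def)
  then show ?thesis
    using component_cong[of "spanning_subgraph G S" G]
    by (simp add: component_verts_comp) (simp add: spanning_subgraph_def)
qed

lemma component_verts_del_arcs: "component_verts (del_arcs G S) = component G (arcs G - S) ` verts G"
proof -
  have "del_arcs G S = spanning_subgraph G (arcs G - S)"
    by (simp add: del_arcs_def spanning_subgraph_def)
  then show ?thesis by (simp add: component_verts_spanning)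
qed

section \<open>Nullity\<close>

text \<open>
  The components of the two ends merge and all others survive.
\<close>

lemma card_components_insert:
  assumes "insert e S \<subseteq> arcs G" "head G e \<notin> component G S (tail G e)"
  shows "card (component G S ` verts G) = Suc (card (component G (insert e S) ` verts G))"
proof -
  let ?X = "component G S (tail G e)" and ?Y = "component G S (head G e)"
  let ?R = "component G S ` (verts G - (?X \<union> ?Y))"
  have ends: "tail G e \<in> verts G" "head G e \<in> verts G" using assms by auto
  have sub: "?X \<subseteq> verts G" "?Y \<subseteq> verts G"
    using assms ends component_subset_verts by auto
  have "?X \<noteq> ?Y" using assms(2) by (metis component_refl)
  have "W \<noteq> ?X \<and> W \<noteq> ?Y \<and> W \<noteq> ?X \<union> ?Y" if W: "W \<in> ?R" for W
  proof -
    obtain v where v: "W = component G S v" "v \<notin> ?X \<union> ?Y" using W by blast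
    have "v \<in> W" unfolding v(1) by (rule component_refl)
    then show ?thesis using v(2) by blast
  qed
  then have out: "?X \<notin> ?R" "?Y \<notin> ?R" "?X \<union> ?Y \<notin> ?R" by blast+
  have split: "verts G = (verts G - (?X \<union> ?Y)) \<union> (?X \<union> ?Y)" using sub by auto
  have old: "component G S ` verts G = insert ?X (insert ?Y ?R)"
    apply (subst split) using component_eq[of _ G S] ends
    by (auto simp: image_Un intro!: imageI)
  have new: "component G (insert e S) ` verts G = insert (?X \<union> ?Y) ?R"
  proof -
    have "component G (insert e S) ` (?X \<union> ?Y) = {?X \<union> ?Y}"
      using component_insert_touching[of _ G S e] component_refl[of "tail G e" G S]
      by (auto simp del: component_refl simp: image_def) 
    moreover have "component G (insert e S) ` (verts G - (?X \<union> ?Y)) = ?R"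
      by (intro image_cong) (auto simp: component_insert_apart)
    moreover have "component G (insert e S) ` verts G =
        component G (insert e S) ` (verts G - (?X \<union> ?Y)) \<union> component G (insert e S) ` (?X \<union> ?Y)"
      using split by (metis image_Un)
    ultimately show ?thesis by simp
  qed
  show ?thesis using \<open>?X \<noteq> ?Y\<close> out by (simp add: old new)
qed

text \<open>
  The nullity in additive form. The inequality established first says that each edge reduces the
  number of components by at most one; it rules out truncation in the definition.
\<close>

lemma nullity_eq:
  assumes "S \<subseteq> arcs G"
  shows "nullity G S + card (verts G) = card S + card (component G S ` verts G)"
proof -
  have bound: "card (verts G) \<le> card S + card (component G S ` verts G)"
  proof -
    have "finite S" using assms finite_edges by simp
    then show ?thesis using assms
    proof (induction S rule: finite_induct)
      case empty
      then show ?case by (simp add: card_image inj_on_def)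
    next
      case (insert e S)
      show ?case
      proof (cases "head G e \<in> component G S (tail G e)")
        case True
        then show ?thesis using insert by (simp add: component_insert_joined cong: image_cong)
      next
        case False
        then show ?thesis using insert card_components_insert[of e S] by simp
      qed
    qed
  qed
  moreover have "card (component G S ` verts G) \<le> card (verts G)"
    by (rule card_image_le) simp
  ultimately show ?thesis
    by (simp add: nullity_def edge_rank_def num_components_def component_verts_spanning[OF assms])
qed

lemma nullity_empty: "nullity G {} = 0"
  using nullity_eq[of "{}"] by (simp add: card_image inj_on_def)

lemma nullity_insert:
  assumes "insert e S \<subseteq> arcs G" "e \<notin> S"
  shows "nullity G (insert e S) =
    (if head G e \<in> component G S (tail G e) then Suc (nullity G S) else nullity G S)"
proof -
  have "finite S" using assms finite_edges by simp
  then show ?thesis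
    using assms nullity_eq[of S] nullity_eq[of "insert e S"] card_components_insert[of e S]
    by (auto simp: component_insert_joined cong: image_cong)
qed

lemma nullity_mono:
  assumes "S \<subseteq> T" "T \<subseteq> arcs G"
  shows "nullity G S \<le> nullity G T"
proof -
  have "finite T" using assms finite_edges by simp
  then have "finite (T - S)" by simp
  have "U \<subseteq> arcs G - S \<Longrightarrow> nullity G S \<le> nullity G (S \<union> U)" if "finite U" for U
    using that
  proof (induction U rule: finite_induct)
    case (insert e U)
    then have "nullity G S \<le> nullity G (S \<union> U)" and "insert e (S \<union> U) \<subseteq> arcs G" and "e \<notin> S \<union> U"
      using assms by auto
    then have "nullity G (S \<union> U) \<le> nullity G (insert e (S \<union> U))"
      using nullity_insert[of e "S \<union> U"] by simp
    then show ?case using \<open>nullity G S \<le> nullity G (S \<union> U)\<close> by simp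
  qed simp
  from this[OF \<open>finite (T - S)\<close>] show ?thesis using assms by (auto simp: Un_absorb1)
qed

end

section \<open>Flows supported on a set of edges\<close>

definition flows_on :: "('v, 'e) pre_digraph \<Rightarrow> 'e set \<Rightarrow> ('v \<Rightarrow> 'f::field) \<Rightarrow> ('e \<Rightarrow> 'f) set" where
  "flows_on G S b = {c \<in> coord_space S. boundary G c = b}"

definition unit_flow :: "'e \<Rightarrow> 'e \<Rightarrow> 'f::field" where
  "unit_flow e = (\<lambda>f. if f = e then 1 else 0)"

lemma coord_space_mono: "S \<subseteq> T \<Longrightarrow> coord_space S \<subseteq> coord_space T"
  by (auto simp: coord_space_def)

lemma flows_on_mono: "S \<subseteq> T \<Longrightarrow> flows_on G S b \<subseteq> flows_on G T b"
  using coord_space_mono by (auto simp: flows_on_def)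

lemma boundary_add: "boundary G (c + d) = boundary G c + boundary G d"
  by (auto simp: boundary_def fun_eq_iff sum.distrib)

lemma boundary_diff: "boundary G (c - d) = boundary G c - boundary G d"
  by (auto simp: boundary_def fun_eq_iff sum_subtractf)

lemma boundary_scale: "boundary G (fun_scale a c) = fun_scale a (boundary G c)"
  by (auto simp: boundary_def fun_eq_iff fun_scale_def sum_distrib_left right_diff_distrib)

lemma flows_on_add:
  "c \<in> flows_on G S b \<Longrightarrow> d \<in> flows_on G S b' \<Longrightarrow> c + d \<in> flows_on G S (b + b')"
  by (simp add: flows_on_def coord_space_def boundary_add)

lemma flows_on_diff:
  "c \<in> flows_on G S b \<Longrightarrow> d \<in> flows_on G S b' \<Longrightarrow> c - d \<in> flows_on G S (b - b')"
  by (simp add: flows_on_def coord_space_def boundary_diff)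

lemma flows_on_scale:
  "c \<in> flows_on G S b \<Longrightarrow> fun_scale a c \<in> flows_on G S (fun_scale a b)"
  by (simp add: flows_on_def boundary_scale) (simp add: coord_space_def fun_scale_def)

lemma flows_on_unit: "e \<in> S \<Longrightarrow> unit_flow e \<in> flows_on G S (boundary G (unit_flow e))"
  by (auto simp: flows_on_def coord_space_def unit_flow_def)

lemma flows_on_delete:
  "c \<in> flows_on G T b \<Longrightarrow> T \<subseteq> insert e S \<Longrightarrow> c e = 0 \<Longrightarrow> c \<in> flows_on G S b"
  by (auto simp: flows_on_def coord_space_def)

lemma zero_circulation: "0 \<in> flows_on G S 0"
  by (simp add: flows_on_def coord_space_def boundary_def fun_eq_iff)

lemma circulations_empty: "flows_on G {} 0 = {0}"
  using zero_circulation[of G "{}"] by (auto simp: flows_on_def coord_space_def fun_eq_iff)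

context fin_digraph
begin

lemma boundary_eq:
  "boundary G c v = (\<Sum>e\<in>arcs G. c e * (of_bool (head G e = v) - of_bool (tail G e = v)))"
proof -
  have "(\<Sum>e\<in>in_arcs G v. c e) = (\<Sum>e\<in>arcs G. c e * of_bool (head G e = v))"
    by (rule sum.mono_neutral_cong_left) (auto simp: in_arcs_def)
  moreover have "(\<Sum>e\<in>out_arcs G v. c e) = (\<Sum>e\<in>arcs G. c e * of_bool (tail G e = v))"
    by (rule sum.mono_neutral_cong_left) (auto simp: out_arcs_def)
  ultimately show ?thesis
    by (simp add: boundary_def right_diff_distrib sum_subtractf)
qed

text \<open>
  An edge with both ends in \<open>U\<close>, or none, cancels; only the edges leaving \<open>U\<close> contribute.
\<close>

lemma sum_boundary:
  assumes "finite U"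
  shows "(\<Sum>v\<in>U. boundary G c v) =
    (\<Sum>e\<in>arcs G. c e * (of_bool (head G e \<in> U) - of_bool (tail G e \<in> U)))"
proof -
  have *: "(\<Sum>v\<in>U. of_bool (x = v)) = (of_bool (x \<in> U) :: 'f::field)" for x
    using assms by (simp add: of_bool_def)
  have "(\<Sum>v\<in>U. boundary G c v) =
      (\<Sum>e\<in>arcs G. \<Sum>v\<in>U. c e * (of_bool (head G e = v) - of_bool (tail G e = v)))"
    by (simp only: boundary_eq) (rule sum.swap)
  then show ?thesis by (simp add: sum_distrib_left[symmetric] sum_subtractf *)
qed

lemma boundary_unit_flow:
  assumes "e \<in> arcs G"
  shows "boundary G (unit_flow e) v = of_bool (head G e = v) - of_bool (tail G e = v)"
proof -
  have "boundary G (unit_flow e) v =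
    (\<Sum>f\<in>arcs G. if f = e then of_bool (head G e = v) - of_bool (tail G e = v) else 0)"
    unfolding boundary_eq by (intro sum.cong) (auto simp: unit_flow_def)
  then show ?thesis using assms by simp
qed

lemma boundary_in_coord_space: "boundary G c \<in> coord_space (verts G)"
  by (auto simp: coord_space_def boundary_eq intro!: sum.neutral)

lemma flows_on_sum_component:
  assumes "c \<in> flows_on G S b" "S \<subseteq> arcs G" "v \<in> verts G"
  shows "(\<Sum>u\<in>component G S v. b u) = 0"
proof -
  have c: "b = boundary G c" "\<And>e. e \<notin> S \<Longrightarrow> c e = 0"
    using assms by (auto simp: flows_on_def coord_space_def)
  have "c e * (of_bool (head G e \<in> component G S v) - of_bool (tail G e \<in> component G S v)) = 0" for e
    using c(2)[of e] component_edge[of e S G v] by (cases "e \<in> S") simp_all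
  then show ?thesis
    unfolding c(1) sum_boundary[OF finite_comp[OF assms(2,3)]] by (intro sum.neutral ballI)
qed

text \<open>
  The converse of \<open>flows_on_sum_component\<close>, by adding edges one at a time. When the new edge \<open>e\<close>
  joins two components, \<open>b\<close> may have opposite nonzero sums \<open>s\<close> and \<open>-s\<close> over them; letting \<open>e\<close>
  carry \<open>-s\<close> leaves a right-hand side whose sums over the old components vanish.
\<close>

lemma flows_on_exists:
  fixes b :: "'a \<Rightarrow> 'f::field"
  assumes "S \<subseteq> arcs G" "b \<in> coord_space (verts G)"
    and "\<And>v. v \<in> verts G \<Longrightarrow> (\<Sum>u\<in>component G S v. b u) = 0"
  shows "flows_on G S b \<noteq> {}"
proof -
  have "finite S" using assms finite_edges by simp
  then show ?thesis using assms
  proof (induction S arbitrary: b rule: finite_induct)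
    case empty
    then have "b = 0" by (auto simp: coord_space_def fun_eq_iff)
    then have "0 \<in> flows_on G {} b" by (simp only: zero_circulation)
    then show ?case by blast
  next
    case (insert e S)
    let ?x = "tail G e" and ?y = "head G e"
    have e: "e \<in> arcs G" and S: "S \<subseteq> arcs G" using insert.prems by auto
    then have xy: "?x \<in> verts G" "?y \<in> verts G" by auto
    show ?case
    proof (cases "?y \<in> component G S ?x")
      case True
      then have "flows_on G S b \<noteq> {}"
        using insert.IH[of b] insert.prems S by (simp add: component_insert_joined)
      then show ?thesis using flows_on_mono[of S "insert e S" G b] by blast
    next
      case False
      let ?X = "component G S ?x" and ?Y = "component G S ?y"
      define s where "s = sum b ?X"
      define b' where "b' = b + fun_scale s (boundary G (unit_flow e))"
      have fin: "finite ?X" "finite ?Y" using finite_comp S xy by auto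
      have disj: "?X \<inter> ?Y = {}" using False component_disjoint[of G S ?x ?y] component_refl by metis
      have "sum b (?X \<union> ?Y) = 0"
        using insert.prems(3)[OF xy(1)] by (simp add: component_insert_touching)
      then have sY: "sum b ?Y = - s"
        using disj fin by (simp add: s_def sum.union_disjoint eq_neg_iff_add_eq_0 add.commute)
      have b'_sum: "sum b' U = sum b U + s * (of_bool (?y \<in> U) - of_bool (?x \<in> U))"
        if "finite U" for U
      proof -
        have "sum b' U = sum b U + s * sum (boundary G (unit_flow e)) U"
          by (simp add: b'_def fun_scale_def sum.distrib sum_distrib_left)
        also have "sum (boundary G (unit_flow e)) U =
            (of_bool (?y \<in> U) - of_bool (?x \<in> U) :: 'f)"
          using that e by (simp add: boundary_unit_flow sum_subtractf of_bool_def)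
        finally show ?thesis .
      qed
      have "flows_on G S b' \<noteq> {}"
      proof (rule insert.IH[OF S])
        show "b' \<in> coord_space (verts G)"
          using insert.prems(2) boundary_in_coord_space[of "unit_flow e"]
          by (auto simp: b'_def coord_space_def fun_scale_def)
      next
        fix v assume v: "v \<in> verts G"
        consider "v \<in> ?X" | "v \<in> ?Y" | "v \<notin> ?X \<union> ?Y" by blast
        then show "sum b' (component G S v) = 0"
        proof cases
          case 1
          then have "component G S v = ?X" by (rule component_eq)
          then show ?thesis using fin disj False by (auto simp: b'_sum s_def)
        next
          case 2
          then have "component G S v = ?Y" by (rule component_eq)
          moreover have "?x \<notin> ?Y" using False by (blast dest: component_sym)
          ultimately show ?thesis using fin by (auto simp: b'_sum sY)
        next
          case 3
          then have "?x \<notin> component G S v" "?y \<notin> component G S v" by (auto dest: component_sym)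
          then show ?thesis
            using insert.prems(3)[OF v] 3 finite_comp[OF S v] by (simp add: b'_sum component_insert_apart)
        qed
      qed
      then obtain c where "c \<in> flows_on G S b'" by blast
      then have "c \<in> flows_on G (insert e S) b'"
        using flows_on_mono[of S "insert e S" G b'] by blast
      then have "c - fun_scale s (unit_flow e) \<in>
          flows_on G (insert e S) (b' - fun_scale s (boundary G (unit_flow e)))"
        by (intro flows_on_diff flows_on_scale flows_on_unit) simp_all
      then show ?thesis unfolding b'_def add_diff_cancel_right' by blast
    qed
  qed
qed

lemma flows_on_nonempty_iff:
  assumes "S \<subseteq> arcs G" "b \<in> coord_space (verts G)"
  shows "flows_on G S b \<noteq> {} \<longleftrightarrow> (\<forall>v\<in>verts G. (\<Sum>u\<in>component G S v. b u) = 0)"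
  using flows_on_exists[OF assms] flows_on_sum_component[OF _ assms(1)] by blast

section \<open>The dimension of the space of circulations\<close>

lemma flows_on_translate:
  assumes "c \<in> flows_on G S b"
  shows "flows_on G S b = (\<lambda>z. c + z) ` flows_on G S 0"
proof
  show "flows_on G S b \<subseteq> (\<lambda>z. c + z) ` flows_on G S 0"
  proof
    fix d assume "d \<in> flows_on G S b"
    then have "d - c \<in> flows_on G S 0"
      using flows_on_diff[OF _ assms] by fastforce
    moreover have "d = c + (d - c)" by simp
    ultimately show "d \<in> (\<lambda>z. c + z) ` flows_on G S 0" by blast
  qed
  show "(\<lambda>z. c + z) ` flows_on G S 0 \<subseteq> flows_on G S b"
    using flows_on_add[OF assms, of _ 0] by auto
qed

lemma subspace_circulations: "fun_space.subspace (flows_on G S (0 :: 'a \<Rightarrow> 'f::field))"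
proof (rule fun_space.subspaceI)
  show "0 \<in> flows_on G S (0 :: 'a \<Rightarrow> 'f)" by (rule zero_circulation)
  show "c + d \<in> flows_on G S (0 :: 'a \<Rightarrow> 'f)"
    if "c \<in> flows_on G S 0" "d \<in> flows_on G S 0" for c d
    using flows_on_add[OF that] by simp
  show "fun_scale a c \<in> flows_on G S (0 :: 'a \<Rightarrow> 'f)" if "c \<in> flows_on G S 0" for a c
    using flows_on_scale[OF that, of a] by simp
qed

text \<open>
  The boundary of \<open>e\<close> alone sums to zero over the components of \<open>S\<close> if both its ends lie in one
  of them, so some flow on \<open>S\<close> carries it back and closes \<open>e\<close> up.
\<close>

lemma circulation_through_edge:
  assumes "insert e S \<subseteq> arcs G" "e \<notin> S" "head G e \<in> component G S (tail G e)"
  obtains z :: "'b \<Rightarrow> 'f::field" where "z \<in> flows_on G (insert e S) 0" "z e = 1"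
proof -
  have e: "e \<in> arcs G" using assms by auto
  have "flows_on G S (- boundary G (unit_flow e) :: 'a \<Rightarrow> 'f) \<noteq> {}"
  proof (rule flows_on_exists)
    show "- boundary G (unit_flow e) \<in> coord_space (verts G)"
      using boundary_in_coord_space[of "unit_flow e"] by (auto simp: coord_space_def)
  next
    fix v assume v: "v \<in> verts G"
    have "head G e \<in> component G S v \<longleftrightarrow> tail G e \<in> component G S v"
      using assms(3) by (blast intro: component_trans component_sym)
    then show "(\<Sum>u\<in>component G S v. (- boundary G (unit_flow e)) u) = (0::'f)"
      using assms finite_comp[of S v] v e
      by (simp add: sum_negf boundary_unit_flow sum_subtractf of_bool_def)
  qed (use assms in auto)
  then obtain c :: "'b \<Rightarrow> 'f" where c: "c \<in> flows_on G S (- boundary G (unit_flow e))" by blast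
  then have "c \<in> flows_on G (insert e S) (- boundary G (unit_flow e))"
    using flows_on_mono[of S "insert e S" G "- boundary G (unit_flow e) :: 'a \<Rightarrow> 'f"] by blast
  then have "c + unit_flow e \<in> flows_on G (insert e S) 0"
    using flows_on_add[OF _ flows_on_unit[of e "insert e S" G]] by fastforce
  moreover have "(c + unit_flow e) e = 1"
    using c assms(2) by (simp add: unit_flow_def flows_on_def coord_space_def)
  ultimately show ?thesis by (rule that)
qed

text \<open>
  The component of the tail of \<open>e\<close> is left by no edge other than \<open>e\<close>, so the net flow out of it
  is the value on \<open>e\<close>.
\<close>

lemma circulation_bridge_zero:
  fixes z :: "'b \<Rightarrow> 'f::field"
  assumes "insert e S \<subseteq> arcs G" "head G e \<notin> component G S (tail G e)"
    and "z \<in> flows_on G (insert e S) 0"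
  shows "z e = 0"
proof -
  let ?X = "component G S (tail G e)"
  have e: "e \<in> arcs G" using assms by auto
  have fin: "finite ?X" using assms finite_comp[of S "tail G e"] by auto
  have "0 = (\<Sum>u\<in>?X. boundary G z u)" using assms by (simp add: flows_on_def)
  also have "\<dots> = (\<Sum>f\<in>arcs G. if f = e then - z e else 0)"
    unfolding sum_boundary[OF fin] using assms component_edge[of _ S G "tail G e"]
    by (intro sum.cong) (auto simp: flows_on_def coord_space_def)
  also have "\<dots> = - z e" using e by simp
  finally show ?thesis by simp
qed

lemma circulations_insert_bridge:
  assumes "insert e S \<subseteq> arcs G" "head G e \<notin> component G S (tail G e)"
  shows "flows_on G (insert e S) 0 = flows_on G S (0 :: 'a \<Rightarrow> 'f::field)"
proof
  show "flows_on G (insert e S) 0 \<subseteq> flows_on G S (0 :: 'a \<Rightarrow> 'f)"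
    using circulation_bridge_zero[OF assms] flows_on_delete[of _ G "insert e S" _ e S] by blast
qed (intro flows_on_mono subset_insertI)

lemma circulation_split:
  fixes z :: "'b \<Rightarrow> 'f::field"
  assumes "z \<in> flows_on G (insert e S) 0" "z e = 1" "d \<in> flows_on G (insert e S) 0"
  shows "d - fun_scale (d e) z \<in> flows_on G S 0"
proof (rule flows_on_delete)
  show "d - fun_scale (d e) z \<in> flows_on G (insert e S) 0"
    using flows_on_diff[OF assms(3) flows_on_scale[OF assms(1), of "d e"]] by simp
qed (use assms(2) in \<open>auto simp: fun_scale_def\<close>)

text \<open>
  A basis is built along the edges: each edge with both ends in one component contributes
  a circulation with value 1 on it, which is independent of those found before because they vanish
  there.
\<close>

lemma circulations_basis:
  assumes "S \<subseteq> arcs G"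
  shows "\<exists>B. finite B \<and> fun_space.independent B \<and>
    fun_space.span B = flows_on G S (0 :: 'a \<Rightarrow> 'f::field) \<and> card B = nullity G S"
proof -
  have "finite S" using assms finite_edges by simp
  then show ?thesis using assms
  proof (induction S rule: finite_induct)
    case empty
    show ?case unfolding circulations_empty nullity_empty
      by (intro exI[of _ "{}"]) (simp add: fun_space.independent_empty)
  next
    case (insert e S)
    then obtain B where B: "finite B" "fun_space.independent B"
      "fun_space.span B = flows_on G S (0 :: 'a \<Rightarrow> 'f)" "card B = nullity G S" by (auto simp: zero_fun_def)
    show ?case
    proof (cases "head G e \<in> component G S (tail G e)")
      case False
      then show ?thesis using B insert
        by (intro exI[of _ B]) (simp add: nullity_insert circulations_insert_bridge[unfolded zero_fun_def] zero_fun_def)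
    next
      case True
      then obtain z :: "'b \<Rightarrow> 'f" where z: "z \<in> flows_on G (insert e S) 0" "z e = 1"
        using circulation_through_edge[of e S] insert by blast
      have notin: "z \<notin> fun_space.span B"
        using z(2) \<open>e \<notin> S\<close> by (auto simp: B(3) flows_on_def coord_space_def)
      have "fun_space.span (insert z B) = flows_on G (insert e S) 0"
      proof (rule fun_space.span_subspace)
        show "insert z B \<subseteq> flows_on G (insert e S) 0"
          using z fun_space.span_superset[of B] B(3) flows_on_mono[of S "insert e S" G] by blast
        show "flows_on G (insert e S) 0 \<subseteq> fun_space.span (insert z B)"
          using circulation_split[OF z] B(3)
          unfolding fun_space.span_breakdown_eq subset_iff mem_Collect_eq by blast
      qed (rule subspace_circulations)
      moreover have "fun_space.independent (insert z B)"
        using notin B(2) by (rule fun_space.independent_insertI)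
      moreover have "z \<notin> B" using notin fun_space.span_base by blast
      moreover have "card (insert z B) = nullity G (insert e S)"
        using B(1,4) \<open>z \<notin> B\<close> True insert by (simp add: nullity_insert)
      ultimately show ?thesis using B(1) unfolding zero_fun_def by blast
    qed
  qed
qed

lemma affine_dim_flows_on:
  fixes b :: "'a \<Rightarrow> 'f::field"
  assumes "S \<subseteq> arcs G" "flows_on G S b \<noteq> {}"
  shows "affine_dim (flows_on G S b) = nullity G S"
proof -
  obtain c where c: "c \<in> flows_on G S b" using assms by blast
  have "{x - y |x y. x \<in> flows_on G S b \<and> y \<in> flows_on G S b} = flows_on G S 0"
  proof (intro set_eqI iffI)
    fix z assume "z \<in> {x - y |x y. x \<in> flows_on G S b \<and> y \<in> flows_on G S b}"
    then show "z \<in> flows_on G S 0" using flows_on_diff[of _ G S b _ b] by auto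
  next
    fix z assume z: "z \<in> flows_on G S (0 :: 'a \<Rightarrow> 'f)"
    have "c + z \<in> flows_on G S b" using flows_on_add[OF c z] by simp
    moreover have "z = (c + z) - c" by simp
    ultimately show "z \<in> {x - y |x y. x \<in> flows_on G S b \<and> y \<in> flows_on G S b}" using c by blast
  qed
  moreover obtain B where "fun_space.independent B"
    "fun_space.span B = flows_on G S (0 :: 'a \<Rightarrow> 'f)" "card B = nullity G S"
    using circulations_basis[OF assms(1)] by blast
  ultimately show ?thesis
    unfolding affine_dim_def by (metis fun_space.dim_span_eq_card_independent)
qed

text \<open>
  The count follows the same induction as the basis: a circulation is determined by its value on
  the new edge and a circulation on the old edges.
\<close>

lemma card_flows_on:
  fixes b :: "'a \<Rightarrow> 'f::field"
  assumes "S \<subseteq> arcs G" "flows_on G S b \<noteq> {}" "finite (UNIV :: 'f set)"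
  shows "card (flows_on G S b) = card (UNIV :: 'f set) ^ nullity G S"
proof -
  have "card (flows_on G S (0 :: 'a \<Rightarrow> 'f)) = card (UNIV :: 'f set) ^ nullity G S"
  proof -
    have "finite S" using assms finite_edges by simp
    then show ?thesis using assms(1)
    proof (induction S rule: finite_induct)
      case empty
      show ?case unfolding circulations_empty nullity_empty by simp
    next
      case (insert e S)
      show ?case
      proof (cases "head G e \<in> component G S (tail G e)")
        case False
        then show ?thesis
          using insert circulations_insert_bridge[of e S, where 'f = 'f]
          by (simp add: nullity_insert zero_fun_def)
      next
        case True
        then obtain z :: "'b \<Rightarrow> 'f" where z: "z \<in> flows_on G (insert e S) 0" "z e = 1"
          using circulation_through_edge[of e S] insert by blast
        let ?Z = "flows_on G S (0 :: 'a \<Rightarrow> 'f)"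
        have "bij_betw (\<lambda>(a, d). d + fun_scale a z) (UNIV \<times> ?Z) (flows_on G (insert e S) 0)"
        proof (rule bij_betw_byWitness[where f' = "\<lambda>d. (d e, d - fun_scale (d e) z)"])
          show "\<forall>p\<in>UNIV \<times> ?Z. (\<lambda>d. (d e, d - fun_scale (d e) z))
              ((\<lambda>(a, d). d + fun_scale a z) p) = p"
            using z \<open>e \<notin> S\<close>
            by (auto simp: flows_on_def coord_space_def fun_scale_def fun_eq_iff)
          show "(\<lambda>(a, d). d + fun_scale a z) ` (UNIV \<times> ?Z) \<subseteq> flows_on G (insert e S) 0"
          proof clarify
            fix a d assume "d \<in> ?Z"
            then have "d \<in> flows_on G (insert e S) 0"
              using flows_on_mono[of S "insert e S" G "0 :: 'a \<Rightarrow> 'f"] by blast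
            then show "d + fun_scale a z \<in> flows_on G (insert e S) 0"
              using fun_space.subspace_add[OF subspace_circulations]
                fun_space.subspace_scale[OF subspace_circulations z(1)] by blast
          qed
        qed (use circulation_split[OF z] in \<open>auto simp: fun_eq_iff\<close>)
        then have "card (flows_on G (insert e S) (0 :: 'a \<Rightarrow> 'f)) = card (UNIV :: 'f set) * card ?Z"
          by (metis bij_betw_same_card card_cartesian_product)
        then show ?thesis using insert True by (simp add: nullity_insert zero_fun_def)
      qed
    qed
  qed
  moreover obtain c where c: "c \<in> flows_on G S b" using assms by blast
  have "card (flows_on G S b) = card (flows_on G S (0 :: 'a \<Rightarrow> 'f))"
    unfolding flows_on_translate[OF c] by (rule card_image) (auto simp: inj_on_def)
  ultimately show ?thesis by simp
qed

end

section \<open>Cut edges\<close>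

text \<open>
  Paths ignore the orientation; they consist of \<open>n\<close> edges and the \<open>n + 1\<close> vertices around them,
  in the same indexing as \<^const>\<open>undirected_cycle\<close>.
\<close>

definition edge_path :: "('v, 'e) pre_digraph \<Rightarrow> 'e set \<Rightarrow> 'v list \<Rightarrow> 'e list \<Rightarrow> bool" where
  "edge_path G S vs es \<longleftrightarrow> length vs = Suc (length es) \<and> set es \<subseteq> S \<and>
     (\<forall>i<length es. {tail G (es ! i), head G (es ! i)} = {vs ! i, vs ! Suc i})"

text \<open>
  The path is extended one edge at a time at its end; if the new vertex has occurred before,
  the path is cut off there.
\<close>

lemma component_path:
  assumes "w \<in> component G S v"
  obtains vs es where "edge_path G S vs es" "distinct vs" "hd vs = v" "last vs = w"
proof -
  have "(w, v) \<in> (edge_rel G S)\<^sup>*" using component_sym[OF assms] by (simp add: component_def)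
  then have "\<exists>vs es. edge_path G S vs es \<and> distinct vs \<and> hd vs = v \<and> last vs = w"
  proof (induction rule: converse_rtrancl_induct)
    case base
    have "edge_path G S [v] []" by (simp add: edge_path_def)
    then show ?case by fastforce
  next
    case (step y z)
    then obtain vs es where p: "edge_path G S vs es" "distinct vs" "hd vs = v" "last vs = z" by blast
    have len: "length vs = Suc (length es)" using p by (simp add: edge_path_def)
    show ?case
    proof (cases "y \<in> set vs")
      case True
      then obtain k where k: "k < length vs" "vs ! k = y" by (auto simp: in_set_conv_nth)
      have "edge_path G S (take (Suc k) vs) (take k es)"
        using p(1) k(1) set_take_subset[of k es] by (auto simp: edge_path_def)
      moreover have "hd (take (Suc k) vs) = v" "last (take (Suc k) vs) = y"
        using p k by (auto simp: take_Suc_conv_app_nth hd_append hd_conv_nth)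
      ultimately show ?thesis using p(2) distinct_take by blast
    next
      case False
      obtain e where e: "e \<in> S" "{tail G e, head G e} = {y, z}"
        using step.hyps(1) by (auto simp: edge_rel_def)
      have "{tail G ((es @ [e]) ! i), head G ((es @ [e]) ! i)} = {(vs @ [y]) ! i, (vs @ [y]) ! Suc i}"
        if "i < Suc (length es)" for i
      proof (cases "i = length es")
        case True
        have "vs ! length es = z" using p(4) len by (metis diff_Suc_1 last_conv_nth length_0_conv nat.distinct(1))
        then show ?thesis using True e len by (auto simp: nth_append)
      next
        case False
        then show ?thesis using that p(1) len by (auto simp: nth_append edge_path_def)
      qed
      then have "edge_path G S (vs @ [y]) (es @ [e])"
        using p(1) e by (auto simp: edge_path_def)
      moreover have "hd (vs @ [y]) = v" using p(3) len by (cases vs) auto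
      ultimately show ?thesis using p(2) False by (metis distinct.simps distinct_append distinct_singleton last_snoc
            disjoint_insert(1) inf_bot_right list.simps(15) set_empty)
    qed
  qed
  then show ?thesis using that by blast
qed

lemma edge_path_distinct_edges:
  assumes "edge_path G S vs es" "distinct vs"
  shows "distinct es"
  unfolding distinct_conv_nth
proof (intro allI impI notI)
  fix i j assume ij: "i < length es" "j < length es" "i \<noteq> j" "es ! i = es ! j"
  then have "{vs ! i, vs ! Suc i} = {vs ! j, vs ! Suc j}"
    using assms(1) unfolding edge_path_def by metis
  moreover have "length vs = Suc (length es)" using assms(1) by (simp add: edge_path_def)
  ultimately show False
    using assms(2) ij by (auto simp: doubleton_eq_iff nth_eq_iff_index_eq)
qed

lemma walk_in_component:
  assumes "\<And>i. i < n \<Longrightarrow> \<exists>e\<in>S. {tail G e, head G e} = {f i, f (Suc i)}"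
  shows "f n \<in> component G S (f 0)"
  using assms
proof (induction n)
  case (Suc n)
  then have "f n \<in> component G S (f 0)" by simp
  moreover obtain e where "e \<in> S" "{tail G e, head G e} = {f n, f (Suc n)}" using Suc.prems by blast
  ultimately show ?case using component_edge[of e S G "f 0"] by (auto simp: doubleton_eq_iff)
qed simp

context fin_digraph
begin

text \<open>
  Going round a cycle through \<open>e\<close> the other way joins the ends of \<open>e\<close> without using \<open>e\<close>;
  conversely \<open>e\<close> closes up a simple path between its ends that avoids it.
\<close>

lemma cut_edges_iff:
  assumes e: "e \<in> arcs G"
  shows "e \<in> cut_edges G \<longleftrightarrow> head G e \<notin> component G (arcs G - {e}) (tail G e)"
proof -
  let ?S = "arcs G - {e}"
  have "head G e \<in> component G ?S (tail G e)"
    if cyc: "undirected_cycle G vs es" and e_in: "e \<in> set es" for vs es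
  proof -
    let ?n = "length vs"
    have n: "?n > 0" "length es = ?n" "distinct es" "set es \<subseteq> arcs G" 
      and step: "\<And>i. i < ?n \<Longrightarrow> {tail G (es ! i), head G (es ! i)} = {vs ! i, vs ! (Suc i mod ?n)}"
      using cyc by (auto simp: undirected_cycle_def)
    obtain k where k: "k < ?n" "es ! k = e" using e_in n(2) by (auto simp: in_set_conv_nth)
    \<comment> \<open>The vertices of the cycle, listed from the one after \<open>e\<close> round to the one before it.\<close>
    define f where "f i = vs ! ((k + 1 + i) mod ?n)" for i
    have "f (?n - 1) \<in> component G ?S (f 0)"
    proof (rule walk_in_component)
      fix i assume i: "i < ?n - 1"
      let ?j = "(k + 1 + i) mod ?n"
      have j: "?j < ?n" using n(1) by simp
      have "?j \<noteq> k"
      proof (cases "k + 1 + i < ?n")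
        case False
        then have "?j = (k + 1 + i - ?n) mod ?n" by (simp add: le_mod_geq)
        also have "\<dots> = k + 1 + i - ?n" using k(1) i by (intro mod_less) linarith
        finally show ?thesis using False i by linarith
      qed simp
      then have "es ! ?j \<in> ?S"
        using j k n nth_eq_iff_index_eq[OF n(3), of ?j k] nth_mem[of ?j es] by auto
      moreover have "Suc ?j mod ?n = (k + 1 + Suc i) mod ?n" by (simp add: mod_Suc_eq)
      ultimately show "\<exists>e\<in>?S. {tail G e, head G e} = {f i, f (Suc i)}"
        using step[OF j] by (auto simp: f_def)
    qed
    moreover have "f 0 = vs ! (Suc k mod ?n)" by (simp add: f_def)
    moreover have "f (?n - 1) = vs ! k" using n(1) k(1) by (simp add: f_def)
    ultimately show ?thesis using step[OF k(1)] k(2)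
      by (auto simp: doubleton_eq_iff dest: component_sym)
  qed
  moreover have "\<exists>vs es. undirected_cycle G vs es \<and> e \<in> set es"
    if conn: "head G e \<in> component G ?S (tail G e)"
  proof -
    obtain vs es where p: "edge_path G ?S vs es" "distinct vs" "hd vs = tail G e" "last vs = head G e"
      using component_path[OF conn] by blast
    have len: "length vs = Suc (length es)" using p by (simp add: edge_path_def)
    have "undirected_cycle G vs (es @ [e])"
      unfolding undirected_cycle_def
    proof (intro conjI allI impI)
      show "distinct (es @ [e])" using edge_path_distinct_edges[OF p(1,2)] p(1) by (auto simp: edge_path_def)
      show "set (es @ [e]) \<subseteq> arcs G" using p(1) e by (auto simp: edge_path_def)
      fix i assume i: "i < length vs"
      show "{tail G ((es @ [e]) ! i), head G ((es @ [e]) ! i)} = {vs ! i, vs ! (Suc i mod length vs)}"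
      proof (cases "i = length es")
        case True
        have "vs ! 0 = tail G e" "vs ! length es = head G e"
          using p(3,4) len by (metis hd_conv_nth length_0_conv nat.distinct(1), metis diff_Suc_1 last_conv_nth length_0_conv nat.distinct(1))
        then show ?thesis using True len by (auto simp: nth_append)
      next
        case False
        then show ?thesis using i len p(1) by (auto simp: nth_append edge_path_def)
      qed
    qed (use p len in auto)
    then show ?thesis by fastforce
  qed
  ultimately show ?thesis using e by (auto simp: cut_edges_def)
qed

section \<open>Compatibility and assignings\<close>

lemma component_verts_induce:
  "Y \<subseteq> verts G \<Longrightarrow> component_verts (G \<restriction> Y) = component G {e \<in> arcs G. tail G e \<in> Y \<and> head G e \<in> Y} ` Y"
proof -
  assume "Y \<subseteq> verts G"
  have "wf_digraph (G \<restriction> Y)" by unfold_locales (auto simp: induce_subgraph_def)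
  then show ?thesis
    using component_cong[of "G \<restriction> Y" G]
    by (simp add: component_verts_comp)
qed

lemma connected_induce:
  "Digraph_Component.connected (G \<restriction> Y) \<longleftrightarrow> Y \<noteq> {} \<and>
     (\<forall>v\<in>Y. Y \<subseteq> component G {e \<in> arcs G. tail G e \<in> Y \<and> head G e \<in> Y} v)"
proof -
  have "wf_digraph (G \<restriction> Y)" by unfold_locales (auto simp: induce_subgraph_def)
  moreover have "component (G \<restriction> Y) (arcs (G \<restriction> Y)) = component G {e \<in> arcs G. tail G e \<in> Y \<and> head G e \<in> Y}"
    using component_cong[of "G \<restriction> Y" G] by (simp add: induce_subgraph_def)
  ultimately show ?thesis
    by (auto simp: connected_def strongly_connected_def reachable_mk_symmetric_comp)
qed

text \<open>
  Let \<open>C\<close> be the component of \<open>G\<close> containing \<open>x\<close>, let \<open>X\<close> be the component of \<open>(V, S)\<close> containing \<open>x\<close>, and let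
  \<open>Y\<close> be a component of \<open>G[C - X]\<close>. Every edge of \<open>G\<close> leaving another component of \<open>G[C - X]\<close> ends
  in \<open>X\<close>, so in \<open>C - Y\<close> everything is still joined to the connected set \<open>X\<close>. Hence removing \<open>Y\<close>
  turns the component \<open>C\<close> into the component \<open>C - Y\<close> and leaves the other components alone.
\<close>

lemma induced_component_in_Lambda:
  assumes S: "S \<subseteq> arcs G" and x: "x \<in> verts G"
    and y: "y \<in> component G (arcs G) x - component G S x"
  defines "W \<equiv> component G (arcs G) x - component G S x"
  shows "component G {e \<in> arcs G. tail G e \<in> W \<and> head G e \<in> W} y \<in> Lambda G"
proof -
  let ?C = "component G (arcs G) x" and ?X = "component G S x"
  let ?T = "{e \<in> arcs G. tail G e \<in> W \<and> head G e \<in> W}"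
  define Y where "Y = component G ?T y"
  have YW: "Y \<subseteq> W" unfolding Y_def
    by (rule component_subsetI) (use y in \<open>auto simp: edge_rel_def W_def\<close>)
  have CV: "?C \<subseteq> verts G" using component_subset_verts[of "arcs G" x] x by simp
  have XC: "?X \<subseteq> ?C" using component_mono[OF S] .
  have yY: "y \<in> Y" by (simp add: Y_def)
  let ?I = "\<lambda>Z. {e \<in> arcs G. tail G e \<in> Z \<and> head G e \<in> Z}"
  let ?R = "verts G - Y"
  have conn: "Digraph_Component.connected (G \<restriction> Y)"
    unfolding connected_induce
  proof (intro conjI ballI)
    show "Y \<noteq> {}" using yY by blast
    fix v assume "v \<in> Y"
    then have "component G ?T v = Y" unfolding Y_def by (rule component_eq)
    then show "Y \<subseteq> component G (?I Y) v"
      using component_within[of G ?T v Y "?I Y"] by auto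
  qed
  \<comment> \<open>A path from \<open>u\<close> to \<open>x\<close> in \<open>G\<close> is followed until it first meets \<open>X\<close>; before that it cannot enter \<open>Y\<close>.\<close>
  have to_x: "u \<in> component G (?I ?R) x" if "u \<in> ?C" "u \<notin> Y" for u
  proof -
    have X_in: "?X \<subseteq> component G (?I ?R) x"
    proof (rule component_within)
      show "e \<in> ?I ?R" if "e \<in> S" "tail G e \<in> ?X" "head G e \<in> ?X" for e
        using that S YW XC CV by (simp add: W_def) blast
    qed simp
    have "(u, x) \<in> (edge_rel G (arcs G))\<^sup>*"
      using component_sym[OF that(1)] by (simp add: component_def)
    then show ?thesis using that(2)
    proof (induction rule: converse_rtrancl_induct)
      case base
      then show ?case by simp
    next
      case (step u w)
      show ?case
      proof (cases "u \<in> ?X")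
        case True
        then show ?thesis using X_in by blast
      next
        case False
        have "x \<in> component G (arcs G) w" using step.hyps(2) by (simp add: component_def)
        then have wC: "w \<in> ?C" by (rule component_sym)
        then have uC: "u \<in> ?C" using component_step[OF step.hyps(1)] by blast
        have "w \<notin> Y"
        proof
          assume "w \<in> Y"
          then have "w \<in> W" "u \<in> W" using YW uC False by (auto simp: W_def)
          then have "(u, w) \<in> edge_rel G ?T"
            using step.hyps(1) by (auto simp: edge_rel_def)
          then have "u \<in> Y" using \<open>w \<in> Y\<close> unfolding Y_def by (rule component_step[THEN iffD2])
          then show False using step.prems by simp
        qed
        then have wx: "w \<in> component G (?I ?R) x" by (rule step.IH)
        have "(u, w) \<in> edge_rel G (?I ?R)"
          using step.hyps(1) \<open>w \<notin> Y\<close> step.prems by (auto simp: edge_rel_def)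
        then show ?thesis using wx by (rule component_step[THEN iffD2])
      qed
    qed
  qed
  have comps: "component G (?I ?R) v = component G (arcs G) v - Y" if v: "v \<in> ?R" for v
  proof
    have "component G (?I ?R) v \<subseteq> component G (arcs G) v" by (rule component_mono) auto
    moreover have "component G (?I ?R) v \<subseteq> ?R"
      by (rule component_subsetI) (use v in \<open>auto simp: edge_rel_def\<close>)
    ultimately show "component G (?I ?R) v \<subseteq> component G (arcs G) v - Y" by blast
    show "component G (arcs G) v - Y \<subseteq> component G (?I ?R) v"
    proof (cases "v \<in> ?C")
      case True
      then have "component G (arcs G) v = ?C" by (rule component_eq)
      then show ?thesis using to_x True v by (blast intro: component_trans component_sym)
    next
      case False
      have "component G (arcs G) v \<noteq> ?C" using False component_refl by metis
      then have "component G (arcs G) v \<inter> Y = {}"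
        using component_disjoint YW by (fastforce simp: W_def)
      then show ?thesis
        using component_within[of G "arcs G" v "component G (arcs G) v" "?I ?R"]
          component_subset_verts[of "arcs G" v] v by auto
    qed
  qed
  have "component G (arcs G) ` verts G = component G (arcs G) ` ?R"
  proof
    show "component G (arcs G) ` verts G \<subseteq> component G (arcs G) ` ?R"
    proof clarify
      fix v assume v: "v \<in> verts G"
      show "component G (arcs G) v \<in> component G (arcs G) ` ?R"
      proof (cases "v \<in> Y")
        case True
        then have "v \<in> ?C" using YW by (auto simp: W_def)
        then have "component G (arcs G) v = ?C" by (rule component_eq)
        moreover have "x \<in> ?R" using x YW by (auto simp: W_def)
        ultimately show ?thesis by blast
      qed (use v in blast)
    qed
  qed blast
  moreover have "component G (?I ?R) ` ?R = (\<lambda>D. D - Y) ` component G (arcs G) ` ?R"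
    unfolding image_image by (intro image_cong) (use comps in auto)
  moreover have "inj_on (\<lambda>D. D - Y) (component G (arcs G) ` ?R)"
  proof (rule inj_onI)
    fix D D' assume "D \<in> component G (arcs G) ` ?R" "D' \<in> component G (arcs G) ` ?R" "D - Y = D' - Y"
    then obtain v v' where "v \<notin> Y" "D = component G (arcs G) v" "D' = component G (arcs G) v'"
      "v \<in> D - Y" by auto
    then show "D = D'" using \<open>D - Y = D' - Y\<close> component_eq[of v G "arcs G" v'] by blast
  qed
  ultimately have "card (component G (?I ?R) ` ?R) = card (component G (arcs G) ` verts G)"
    by (simp add: card_image)
  then have "num_components (G \<restriction> ?R) = num_components G"
    unfolding num_components_def component_verts_comp[OF wf_digraph]
    by (simp only: component_verts_induce[OF Diff_subset])
  moreover have "Y \<subseteq> verts G" using YW CV by (auto simp: W_def)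
  ultimately show ?thesis using conn yY unfolding Lambda_def Y_def[symmetric] by blast
qed

lemma b_compatible_iff:
  assumes "b \<in> coord_space (verts G)"
  shows "b_compatible b (del_arcs G S) \<longleftrightarrow> flows_on G (arcs G - S) b \<noteq> {}"
  using assms by (auto simp: b_compatible_def component_verts_del_arcs flows_on_nonempty_iff)

lemma assigning_eq_sum_zero:
  assumes "assigning G b = assigning G b'" "X \<in> Lambda G" "(\<Sum>v\<in>X. b v) = 0"
  shows "(\<Sum>v\<in>X. b' v) = 0"
  using fun_cong[OF assms(1), of X] assms(2,3) by (simp add: assigning_def split: if_splits)

text \<open>
  Here \<open>C\<close>, \<open>X\<close> and \<open>W = C - X\<close> are as in \<open>induced_component_in_Lambda\<close>, and \<open>S\<close> is the set of
  edges that are kept. The components of \<open>G[W]\<close> belong to \<^const>\<open>Lambda\<close> and are unions of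
  components of \<open>(V, S)\<close>, so \<open>b\<close> sums to zero over them, hence so does \<open>b'\<close>. Therefore \<open>b'\<close> sums to
  zero over \<open>W\<close>; being a boundary it does so over \<open>C\<close>, and subtraction leaves \<open>X\<close>.
\<close>

lemma compatible_transfer:
  fixes b b' :: "'a \<Rightarrow> 'f::field"
  assumes S: "S \<subseteq> arcs G" and b': "flows_on G (arcs G) b' \<noteq> {}"
    and alpha: "assigning G b = assigning G b'" and b: "flows_on G S b \<noteq> {}"
  shows "flows_on G S b' \<noteq> {}"
proof (rule flows_on_exists[OF S])
  show "b' \<in> coord_space (verts G)" using b' boundary_in_coord_space by (auto simp: flows_on_def)
next
  fix x assume x: "x \<in> verts G"
  let ?C = "component G (arcs G) x" and ?X = "component G S x"
  let ?W = "?C - ?X"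
  let ?T = "{e \<in> arcs G. tail G e \<in> ?W \<and> head G e \<in> ?W}"
  have fin: "finite ?C" using finite_comp[OF subset_refl x] .
  have XC: "?X \<subseteq> ?C" using component_mono[OF S] .
  have TW: "component G ?T y \<subseteq> ?W" if "y \<in> ?W" for y
    by (rule component_subsetI) (use that in \<open>auto simp: edge_rel_def\<close>)
  have b_sum: "(\<Sum>v\<in>component G S y. b v) = 0" if "y \<in> verts G" for y
    using b S that flows_on_sum_component by blast
  have "(\<Sum>v\<in>component G ?T y. b' v) = 0" if y: "y \<in> ?W" for y
  proof (rule assigning_eq_sum_zero[OF alpha])
    show "component G ?T y \<in> Lambda G"
      using induced_component_in_Lambda[OF S x] y by simp
    let ?Y = "component G ?T y"
    have sub: "component G S u \<subseteq> ?Y" if u: "u \<in> ?Y" for u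
    proof -
      have uW: "u \<in> ?W" using TW[OF y] u by blast
      have "component G S u \<subseteq> component G ?T u"
      proof (rule component_within)
        show "component G S u \<subseteq> ?W"
        proof
          fix w assume w: "w \<in> component G S u"
          then have "w \<in> ?C"
            using uW component_mono[OF S, of G u] by (blast intro: component_trans)
          moreover have "w \<notin> ?X" using w uW by (blast intro: component_trans component_sym)
          ultimately show "w \<in> ?W" by blast
        qed
      qed (use S in auto)
      then show ?thesis using component_eq[OF u] by simp
    qed
    have Y_verts: "?Y \<subseteq> verts G" using TW[OF y] component_subset_verts[OF subset_refl x] by blast
    then have "finite ?Y" by (rule finite_subset) simp
    then have "sum b ?Y = (\<Sum>U\<in>component G S ` ?Y. sum b U)" using sub by (rule sum_components)
    also have "\<dots> = 0" using Y_verts b_sum by (intro sum.neutral) blast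
    finally show "sum b ?Y = 0" .
  qed
  then have "(\<Sum>U\<in>component G ?T ` ?W. sum b' U) = 0" by (intro sum.neutral) blast
  then have "sum b' ?W = 0" using sum_components[of ?W G ?T b'] fin TW by simp
  moreover have "sum b' ?C = 0" using b' flows_on_sum_component[OF _ subset_refl x] by blast
  ultimately show "sum b' ?X = 0" using sum.subset_diff[OF XC fin, of b'] by simp
qed

end

section \<open>Alternating sums over subsets\<close>

lemma sum_Pow_insert:
  assumes "finite A" "a \<notin> A"
  shows "(\<Sum>B\<in>Pow (insert a A). f B) = (\<Sum>B\<in>Pow A. f B + f (insert a B))"
proof -
  have "inj_on (insert a) (Pow A)" using assms by (auto simp: inj_on_def)
  then have "(\<Sum>B\<in>insert a ` Pow A. f B) = (\<Sum>B\<in>Pow A. f (insert a B))"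
    by (simp add: sum.reindex)
  moreover have "Pow A \<inter> insert a ` Pow A = {}" using assms by auto
  ultimately show ?thesis
    using assms by (simp add: Pow_insert sum.union_disjoint sum.distrib)
qed

lemma alternating_sum_Pow_insert:
  fixes g :: "'a set \<Rightarrow> 'r::comm_ring_1"
  assumes "finite A" "a \<notin> A"
  shows "(\<Sum>B\<in>Pow (insert a A). (-1) ^ card B * g B) =
    (\<Sum>B\<in>Pow A. (-1) ^ card B * (g B - g (insert a B)))"
proof -
  have "card (insert a B) = Suc (card B)" if "B \<in> Pow A" for B
    using that assms by (metis PowD card_insert_disjoint finite_subset subsetD)
  then show ?thesis
    unfolding sum_Pow_insert[OF assms] by (intro sum.cong) (auto simp: algebra_simps)
qed

text \<open>
  Subsets with and without \<open>a\<close> pair off with opposite signs.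
\<close>

lemma alternating_sum_cancel:
  fixes g :: "'a set \<Rightarrow> 'r::comm_ring_1"
  assumes "finite A" "a \<in> A" "\<And>B. B \<subseteq> A \<Longrightarrow> g (insert a B) = g B"
  shows "(\<Sum>B\<in>Pow A. (-1) ^ card B * g B) = 0"
proof -
  have A: "A = insert a (A - {a})" using assms by auto
  have "(\<Sum>B\<in>Pow (insert a (A - {a})). (-1) ^ card B * g B) = 0"
  proof (subst alternating_sum_Pow_insert)
    have "g B - g (insert a B) = 0" if "B \<in> Pow (A - {a})" for B
      using assms(3)[OF order.trans[of B "A - {a}"]] that by auto
    then show "(\<Sum>B\<in>Pow (A - {a}). (-1) ^ card B * (g B - g (insert a B))) = 0"
      by (intro sum.neutral) simp
  qed (use assms in auto)
  then show ?thesis using A by simp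
qed

text \<open>
  The signed number of index sets \<open>S\<close> with a given image is the sign of that image: over each
  point the nonempty subsets of the fibre have signed count \<open>-1\<close>. This lets an arrangement
  be indexed with repetitions. The induction leaves \<open>g\<close> arbitrary because adding an index
  replaces \<open>g\<close> by a difference; if its image is already present, the subtracted sum cancels
  in pairs.
\<close>

lemma alternating_sum_image:
  fixes g :: "'b set \<Rightarrow> 'r::comm_ring_1"
  assumes "finite I"
  shows "(\<Sum>B\<in>Pow (h ` I). (-1) ^ card B * g B) = (\<Sum>S\<in>Pow I. (-1) ^ card S * g (h ` S))"
  using assms
proof (induction I arbitrary: g rule: finite_induct)
  case (insert i I)
  let ?g = "\<lambda>B. g B - g (insert (h i) B)"
  have "(\<Sum>S\<in>Pow (insert i I). (-1) ^ card S * g (h ` S)) =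
      (\<Sum>S\<in>Pow I. (-1) ^ card S * ?g (h ` S))"
    using insert by (simp add: alternating_sum_Pow_insert)
  also have "\<dots> = (\<Sum>B\<in>Pow (h ` I). (-1) ^ card B * ?g B)"
    using insert.IH[of ?g] by simp
  also have "\<dots> = (\<Sum>B\<in>Pow (h ` insert i I). (-1) ^ card B * g B)"
  proof (cases "h i \<in> h ` I")
    case True
    have "(\<Sum>B\<in>Pow (h ` I). (-1) ^ card B * g (insert (h i) B)) = 0"
      using True insert.hyps by (intro alternating_sum_cancel) auto
    then show ?thesis
      using True by (simp add: right_diff_distrib sum_subtractf insert_absorb)
  next
    case False
    then show ?thesis using insert.hyps by (simp add: alternating_sum_Pow_insert)
  qed
  finally show ?case by simp
qed simp

lemma alternating_sum_Pow:
  assumes "finite A"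
  shows "(\<Sum>B\<in>Pow A. (-1) ^ card B :: 'r::comm_ring_1) = of_bool (A = {})"
  using assms alternating_sum_cancel[of A _ "\<lambda>_. 1 :: 'r"] by (cases "A = {}") auto

section \<open>The expansion over edge sets\<close>

lemma monom_sign: "monom ((-1) ^ k) n = (-1) ^ k * (monom 1 n :: int poly)"
  by (cases "even k") (simp_all add: minus_monom)

lemma coeff_sign: "coeff ((-1) ^ k * p) n = (-1) ^ k * coeff (p :: int poly) n"
  by (cases "even k") simp_all

lemma arr_char_poly_eq:
  assumes "finite \<A>"
  shows "arr_char_poly V \<A> =
    (\<Sum>\<B>\<in>Pow \<A>. (-1) ^ card \<B> *
      (if V \<inter> \<Inter>\<B> = {} then 0 else monom 1 (affine_dim (V \<inter> \<Inter>\<B>))))"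
  unfolding arr_char_poly_def
  by (rule sum.mono_neutral_cong_left) (use assms in \<open>auto simp: monom_sign\<close>)

text \<open>
  The contribution of \<open>S\<close> without its sign. The test for solvability serves all three
  polynomials: nonempty intersection, \<open>b\<close>-compatibility, and membership of \<open>\<pi>(E - S)\<close> in \<open>\<Pi>\<^sub>b\<close>.
\<close>

definition flow_term :: "('v, 'e) pre_digraph \<Rightarrow> ('v \<Rightarrow> 'f::field) \<Rightarrow> 'e set \<Rightarrow> int poly" where
  "flow_term G b S =
     (if flows_on G (arcs G - S) b = {} then 0 else monom 1 (nullity G (arcs G - S)))"

context fin_digraph
begin

lemma flows_inter_hyperplanes:
  "flows G b \<inter> \<Inter> ((\<lambda>e. edge_hyperplane G e \<inter> flows G b) ` S) = flows_on G (arcs G - S) b"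
  by (auto simp: flows_def flows_on_def edge_hyperplane_def coord_space_def)

lemma flow_arr_eq: "flow_arr G b = (\<lambda>e. edge_hyperplane G e \<inter> flows G b) ` arcs G - {{}}"
  by (auto simp: flow_arr_def)

text \<open>
  The arrangement is enlarged by the empty set, which only adds families with empty
  intersection, so that it can be indexed by all edges.
\<close>

lemma char_poly_expansion:
  "arr_char_poly (flows G b) (flow_arr G b) = (\<Sum>S\<in>Pow (arcs G). (-1) ^ card S * flow_term G b S)"
proof -
  let ?h = "\<lambda>e. edge_hyperplane G e \<inter> flows G b"
  let ?g = "\<lambda>\<B>. if flows G b \<inter> \<Inter>\<B> = {} then 0
    else monom 1 (affine_dim (flows G b \<inter> \<Inter>\<B>)) :: int poly"
  have "arr_char_poly (flows G b) (flow_arr G b) =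
      (\<Sum>\<B>\<in>Pow (flow_arr G b). (-1) ^ card \<B> * ?g \<B>)"
    by (rule arr_char_poly_eq) (simp add: flow_arr_eq)
  also have "\<dots> = (\<Sum>\<B>\<in>Pow (?h ` arcs G). (-1) ^ card \<B> * ?g \<B>)"
  proof (rule sum.mono_neutral_left)
    show "\<forall>\<B>\<in>Pow (?h ` arcs G) - Pow (flow_arr G b). (-1) ^ card \<B> * ?g \<B> = 0"
    proof
      fix \<B> assume "\<B> \<in> Pow (?h ` arcs G) - Pow (flow_arr G b)"
      then have "{} \<in> \<B>" by (auto simp: flow_arr_eq)
      then have "flows G b \<inter> \<Inter>\<B> = {}" by blast
      then show "(-1) ^ card \<B> * ?g \<B> = 0" by simp
    qed
  qed (auto simp: flow_arr_eq)
  also have "\<dots> = (\<Sum>S\<in>Pow (arcs G). (-1) ^ card S * ?g (?h ` S))"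
    by (rule alternating_sum_image) simp
  also have "\<dots> = (\<Sum>S\<in>Pow (arcs G). (-1) ^ card S * flow_term G b S)"
    unfolding flows_inter_hyperplanes flow_term_def
    by (intro sum.cong) (simp_all add: affine_dim_flows_on)
  finally show ?thesis .
qed

lemma boundaries_del_arcs: "b \<in> boundaries (del_arcs G T) \<longleftrightarrow> flows_on G (arcs G - T) b \<noteq> {}"
proof -
  have "boundary (del_arcs G T) c = boundary G c" if c: "c \<in> coord_space (arcs G - T)" for c :: "'b \<Rightarrow> 'c"
  proof
    fix v
    have "(\<Sum>e\<in>in_arcs (del_arcs G T) v. c e) = (\<Sum>e\<in>in_arcs G v. c e)"
      by (rule sum.mono_neutral_left) (use c in \<open>auto simp: del_arcs_def coord_space_def\<close>)
    moreover have "(\<Sum>e\<in>out_arcs (del_arcs G T) v. c e) = (\<Sum>e\<in>out_arcs G v. c e)"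
      by (rule sum.mono_neutral_left) (use c in \<open>auto simp: del_arcs_def coord_space_def\<close>)
    ultimately show "boundary (del_arcs G T) c v = boundary G c v" by (simp add: boundary_def)
  qed
  moreover have "arcs (del_arcs G T) = arcs G - T" by (simp add: del_arcs_def)
  ultimately show ?thesis
    by (auto simp: boundaries_def flows_on_def image_iff)
qed

lemma boundaries_iff: "b \<in> boundaries G \<longleftrightarrow> flows_on G (arcs G) b \<noteq> {}"
  by (auto simp: boundaries_def flows_on_def image_iff)

lemma boundaries_coord_space: "b \<in> boundaries G \<Longrightarrow> b \<in> coord_space (verts G)"
  using boundary_in_coord_space by (auto simp: boundaries_def)

section \<open>The assigning polynomial and the flow polynomial\<close>

lemma compatible_sum:
  assumes "b \<in> coord_space (verts G)"
  shows "(\<Sum>S | S \<subseteq> arcs G \<and> b_compatible b (del_arcs G S).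
      monom ((-1) ^ card S) (nullity G (arcs G - S))) =
    (\<Sum>S\<in>Pow (arcs G). (-1) ^ card S * flow_term G b S)"
  by (rule sum.mono_neutral_cong_left)
    (auto simp: b_compatible_iff[OF assms] flow_term_def monom_sign)

text \<open>
  The definite description is legitimate because all representations \<open>b'\<close> of the same assigning
  have the same compatible edge sets.
\<close>

lemma assigning_poly_expansion:
  fixes b :: "'a \<Rightarrow> 'f::field"
  assumes b: "b \<in> boundaries G"
  shows "assigning_poly TYPE('f) G (assigning G b) =
    (\<Sum>S\<in>Pow (arcs G). (-1) ^ card S * flow_term G b S)"
  unfolding assigning_poly_def
proof (rule the_equality)
  show "\<exists>b'::'a \<Rightarrow> 'f. b' \<in> boundaries G \<and> assigning G b = assigning G b' \<and>
      (\<Sum>S\<in>Pow (arcs G). (-1) ^ card S * flow_term G b S) =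
      (\<Sum>S | S \<subseteq> arcs G \<and> b_compatible b' (del_arcs G S).
         monom ((-1) ^ card S) (nullity G (arcs G - S)))"
    using b compatible_sum[OF boundaries_coord_space[OF b]] by (intro exI[of _ b]) simp
next
  fix p :: "int poly" assume "\<exists>b'::'a \<Rightarrow> 'f. b' \<in> boundaries G \<and> assigning G b = assigning G b' \<and>
      p = (\<Sum>S | S \<subseteq> arcs G \<and> b_compatible b' (del_arcs G S).
         monom ((-1) ^ card S) (nullity G (arcs G - S)))"
  then obtain b' :: "'a \<Rightarrow> 'f" where b': "b' \<in> boundaries G" "assigning G b = assigning G b'"
    and p: "p = (\<Sum>S\<in>Pow (arcs G). (-1) ^ card S * flow_term G b' S)"
    using compatible_sum boundaries_coord_space by auto
  have "flow_term G b' S = flow_term G b S" for S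
    using compatible_transfer[of "arcs G - S" b' b] compatible_transfer[of "arcs G - S" b b']
      b b' by (auto simp: flow_term_def boundaries_iff)
  then show "p = (\<Sum>S\<in>Pow (arcs G). (-1) ^ card S * flow_term G b S)" by (simp add: p)
qed

lemma edge_partition_in_partitions_of:
  assumes "S \<subseteq> arcs G" "b \<in> coord_space (verts G)"
  shows "edge_partition G S \<in> partitions_of G b \<longleftrightarrow> flows_on G S b \<noteq> {}"
  using assms by (auto simp: partitions_of_def partitions_def block_zero_def edge_partition_def
      component_verts_spanning flows_on_nonempty_iff)

lemma partition_flow_poly_expansion:
  assumes "b \<in> boundaries G"
  shows "partition_flow_poly G (partitions_of G b) =
    (\<Sum>S\<in>Pow (arcs G). (-1) ^ card S * flow_term G b S)"
proof -
  have "partition_flow_poly G (partitions_of G b) =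
      (\<Sum>S\<in>Pow (arcs G). (-1) ^ card (arcs G - S) * flow_term G b (arcs G - S))"
    unfolding partition_flow_poly_def
    by (rule sum.mono_neutral_cong_left)
      (auto simp: edge_partition_in_partitions_of boundaries_coord_space[OF assms]
        flow_term_def monom_sign double_diff)
  also have "\<dots> = (\<Sum>S\<in>Pow (arcs G). (-1) ^ card S * flow_term G b S)"
    by (rule sum.reindex_bij_witness[of _ "\<lambda>S. arcs G - S" "\<lambda>S. arcs G - S"])
      (auto simp: double_diff)
  finally show ?thesis .
qed

lemma partition_flow_poly_zero:
  "partition_flow_poly G (partitions_of G ((\<lambda>_. 0) :: 'a \<Rightarrow> 'f::field)) = flow_poly G"
proof -
  have "{S. S \<subseteq> arcs G \<and> edge_partition G S \<in> partitions_of G ((\<lambda>_. 0) :: 'a \<Rightarrow> 'f)} = Pow (arcs G)"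
    by (auto simp: partitions_of_def partitions_def block_zero_def coord_space_def)
  then show ?thesis by (simp add: partition_flow_poly_def flow_poly_def)
qed

section \<open>Cut edges decide between degree and vanishing\<close>

lemma cut_edges_of_iff:
  "e \<in> cut_edges_of G b \<longleftrightarrow> e \<in> arcs G \<and>
     head G e \<notin> component G (arcs G - {e}) (tail G e) \<and> flows_on G (arcs G - {e}) b \<noteq> {}"
proof (cases "e \<in> arcs G")
  case True
  then show ?thesis by (simp add: cut_edges_of_def boundaries_del_arcs cut_edges_iff)
qed (simp add: cut_edges_of_def cut_edges_def)

text \<open>
  If all flows vanish on \<open>e\<close>, then no circulation passes through \<open>e\<close>, since adding one to a flow
  would change the value on \<open>e\<close>. So \<open>e\<close> is a cut edge, and any flow lives on \<open>E - e\<close>.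
\<close>

lemma flows_not_in_flow_arr:
  fixes b :: "'a \<Rightarrow> 'f::field"
  assumes b: "b \<in> boundaries G" and "cut_edges_of G b = {}"
  shows "flows G b \<notin> flow_arr G b"
proof
  assume "flows G b \<in> flow_arr G b"
  then obtain e where e: "e \<in> arcs G" and zero: "\<And>c. c \<in> flows_on G (arcs G) b \<Longrightarrow> c e = 0"
    by (auto simp: flow_arr_def edge_hyperplane_def flows_on_def flows_def set_eq_iff)
  have ins: "insert e (arcs G - {e}) = arcs G" using e by blast
  obtain c where c: "c \<in> flows_on G (arcs G) b" using b boundaries_iff by blast
  have "c \<in> flows_on G (arcs G - {e}) b"
    by (rule flows_on_delete[OF c _ zero[OF c]]) blast
  moreover have "head G e \<notin> component G (arcs G - {e}) (tail G e)"
  proof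
    assume "head G e \<in> component G (arcs G - {e}) (tail G e)"
    then obtain z :: "'b \<Rightarrow> 'f" where z: "z \<in> flows_on G (arcs G) 0" "z e = 1"
      using circulation_through_edge[of e "arcs G - {e}"] unfolding ins by blast
    have "c + z \<in> flows_on G (arcs G) b" using flows_on_add[OF c z(1)] by simp
    then show False using zero[of "c + z"] zero[OF c] z(2) by simp
  qed
  ultimately have "e \<in> cut_edges_of G b" using e cut_edges_of_iff by blast
  then show False using assms by blast
qed

text \<open>
  A flow vanishing on \<open>S\<close> vanishes on each \<open>e \<in> S\<close>, so by hypothesis \<open>e\<close> is no cut edge and deleting
  it alone already lowers the nullity.
\<close>

lemma nullity_less:
  assumes "cut_edges_of G b = {}" "S \<subseteq> arcs G" "S \<noteq> {}" "flows_on G (arcs G - S) b \<noteq> {}"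
  shows "nullity G (arcs G - S) < nullity G (arcs G)"
proof -
  obtain e where e: "e \<in> S" "e \<in> arcs G" using assms by blast
  have "flows_on G (arcs G - {e}) b \<noteq> {}"
    using assms(4) flows_on_mono[of "arcs G - S" "arcs G - {e}" G b] e by blast
  then have "head G e \<in> component G (arcs G - {e}) (tail G e)"
    using assms(1) e cut_edges_of_iff by blast
  then have "nullity G (arcs G) = Suc (nullity G (arcs G - {e}))"
    using nullity_insert[of e "arcs G - {e}"] e by (simp add: insert_absorb)
  moreover have "nullity G (arcs G - S) \<le> nullity G (arcs G - {e})"
    by (rule nullity_mono) (use e in auto)
  ultimately show ?thesis by simp
qed

text \<open>
  Only the empty set contributes a term of degree \<open>n(G)\<close>.
\<close>

lemma char_poly_monic:
  assumes "b \<in> boundaries G" "cut_edges_of G b = {}"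
  defines "P \<equiv> \<Sum>S\<in>Pow (arcs G). (-1) ^ card S * flow_term G b S"
  shows "degree P = nullity G (arcs G)" and "lead_coeff P = 1"
proof -
  let ?N = "nullity G (arcs G)"
  have term_zero: "coeff (flow_term G b S) k = 0" if "S \<in> Pow (arcs G) - {{}}" "k \<ge> ?N" for S k
  proof (cases "flows_on G (arcs G - S) b = {}")
    case False
    then have "nullity G (arcs G - S) < k" using nullity_less[OF assms(2) _ _ False] that by auto
    then show ?thesis by (simp add: flow_term_def)
  qed (simp add: flow_term_def)
  have high: "coeff P k = coeff (monom 1 ?N) k" if "k \<ge> ?N" for k
  proof -
    have "coeff P k = (\<Sum>S\<in>Pow (arcs G). (-1) ^ card S * coeff (flow_term G b S) k)"
      by (simp add: P_def coeff_sum coeff_sign)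
    also have "\<dots> = (\<Sum>S\<in>{{}}. (-1) ^ card S * coeff (flow_term G b S) k)"
      by (rule sum.mono_neutral_right) (use term_zero that in auto)
    also have "\<dots> = coeff (monom 1 ?N) k"
      using assms(1) by (simp add: flow_term_def boundaries_iff)
    finally show ?thesis .
  qed
  have "degree P \<le> ?N" by (rule degree_le) (use high in auto)
  moreover have "?N \<le> degree P" by (rule le_degree) (use high in auto)
  ultimately show "degree P = ?N" by simp
  then show "lead_coeff P = 1" using high[of ?N] by simp
qed

text \<open>
  For a cut edge \<open>e\<close> one flow vanishing on \<open>e\<close> forces all to do so, because two flows differ by a
  circulation. Deleting \<open>e\<close> in addition to \<open>S\<close> then changes neither the flows nor the nullity.
\<close>

lemma char_poly_vanishes:
  fixes b :: "'a \<Rightarrow> 'f::field"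
  assumes "cut_edges_of G b \<noteq> {}"
  shows "(\<Sum>S\<in>Pow (arcs G). (-1) ^ card S * flow_term G b S) = 0"
proof -
  obtain e where e: "e \<in> arcs G" "head G e \<notin> component G (arcs G - {e}) (tail G e)"
    and "flows_on G (arcs G - {e}) b \<noteq> {}"
    using assms cut_edges_of_iff by blast
  then obtain c\<^sub>0 where c\<^sub>0: "c\<^sub>0 \<in> flows_on G (arcs G - {e}) b" by blast
  have ins: "insert e (arcs G - {e}) = arcs G" using e by blast
  have zero: "c e = 0" if c: "c \<in> flows_on G (arcs G) b" for c
  proof -
    have "c\<^sub>0 \<in> flows_on G (arcs G) b" using c\<^sub>0 flows_on_mono[of "arcs G - {e}" "arcs G" G b] by blast
    then have "c - c\<^sub>0 \<in> flows_on G (arcs G) 0" using flows_on_diff[OF c] by fastforce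
    then have "(c - c\<^sub>0) e = 0"
      using circulation_bridge_zero[of e "arcs G - {e}" "c - c\<^sub>0"] e ins by simp
    moreover have "c\<^sub>0 e = 0" using c\<^sub>0 by (simp add: flows_on_def coord_space_def)
    ultimately show ?thesis by simp
  qed
  show ?thesis
  proof (rule alternating_sum_cancel[OF finite_arcs e(1)])
    fix S assume S: "S \<subseteq> arcs G"
    show "flow_term G b (insert e S) = flow_term G b S"
    proof (cases "e \<in> S")
      case False
      let ?T = "arcs G - insert e S"
      have T: "arcs G - S = insert e ?T" using False e by blast
      have "head G e \<notin> component G ?T (tail G e)"
        using e(2) component_mono[of ?T "arcs G - {e}" G "tail G e"] by blast
      then have "nullity G (arcs G - S) = nullity G ?T"
        using nullity_insert[of e ?T] e T by simp
      moreover have "flows_on G (arcs G - S) b = flows_on G ?T b"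
      proof
        show "flows_on G (arcs G - S) b \<subseteq> flows_on G ?T b"
        proof
          fix c assume c: "c \<in> flows_on G (arcs G - S) b"
          then have "c e = 0" using flows_on_mono[of "arcs G - S" "arcs G" G b] zero by blast
          then show "c \<in> flows_on G ?T b" by (rule flows_on_delete[OF c, rotated]) (use T in blast)
        qed
      qed (intro flows_on_mono, auto)
      ultimately show ?thesis by (simp add: flow_term_def)
    qed (simp add: insert_absorb)
  qed
qed

section \<open>Counting over a finite field\<close>

lemma card_filter_eq_sum:
  assumes "finite A"
  shows "int (card {x \<in> A. P x}) = (\<Sum>x\<in>A. of_bool (P x))"
proof -
  have "int (card {x \<in> A. P x}) = (\<Sum>x\<in>{x \<in> A. P x}. 1)" by simp
  also have "\<dots> = (\<Sum>x\<in>A. if P x then 1 else 0)" using assms by (rule sum.inter_filter)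
  finally show ?thesis by (simp only: of_bool_def)
qed

lemma arr_complement_flow_arr: "arr_complement (flows G b) (flow_arr G b) = nz_flows G b"
  by (auto simp: arr_complement_def flow_arr_def nz_flows_def flows_def edge_hyperplane_def)

text \<open>
  After exchanging sums, a flow \<open>c\<close> is counted with the alternating sum over the subsets of its
  zero set, which is 1 if \<open>c\<close> has no zero and 0 otherwise.
\<close>

lemma card_nz_flows:
  fixes b :: "'a \<Rightarrow> 'f::field"
  assumes "finite (UNIV :: 'f set)" "b \<in> boundaries G"
  shows "poly (\<Sum>S\<in>Pow (arcs G). (-1) ^ card S * flow_term G b S) (int (card (UNIV :: 'f set))) =
    int (card (nz_flows G b))"
proof -
  let ?q = "card (UNIV :: 'f set)" and ?F = "flows_on G (arcs G) b"
  let ?Z = "\<lambda>c. {e \<in> arcs G. c e = 0}"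
  have "?q > 0" using assms(1) by (simp add: card_gt_0_iff)
  then have "card ?F > 0"
    using card_flows_on[OF subset_refl _ assms(1), of b] assms(2)[unfolded boundaries_iff] by simp
  then have fin: "finite ?F" by (rule card_ge_0_finite)
  have term_eq: "poly (flow_term G b S) (int ?q) = (\<Sum>c\<in>?F. of_bool (S \<subseteq> ?Z c))"
    if S: "S \<in> Pow (arcs G)" for S
  proof -
    have "poly (flow_term G b S) (int ?q) = int (card (flows_on G (arcs G - S) b))"
      using card_flows_on[OF _ _ assms(1), of "arcs G - S" b]
      by (auto simp: flow_term_def poly_monom)
    also have "flows_on G (arcs G - S) b = {c \<in> ?F. S \<subseteq> ?Z c}"
      using S by (auto simp: flows_on_def coord_space_def)
    also have "int (card \<dots>) = (\<Sum>c\<in>?F. of_bool (S \<subseteq> ?Z c))"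
      using fin by (rule card_filter_eq_sum)
    finally show ?thesis .
  qed
  have "poly (\<Sum>S\<in>Pow (arcs G). (-1) ^ card S * flow_term G b S) (int ?q) =
      (\<Sum>S\<in>Pow (arcs G). \<Sum>c\<in>?F. (-1) ^ card S * of_bool (S \<subseteq> ?Z c))"
    by (simp add: poly_sum term_eq sum_distrib_left)
  also have "\<dots> = (\<Sum>c\<in>?F. \<Sum>S\<in>Pow (arcs G). (-1) ^ card S * of_bool (S \<subseteq> ?Z c))"
    by (rule sum.swap)
  also have "\<dots> = (\<Sum>c\<in>?F. of_bool (?Z c = {}))"
  proof (intro sum.cong refl)
    fix c
    have "(\<Sum>S\<in>Pow (arcs G). (-1) ^ card S * of_bool (S \<subseteq> ?Z c)) =
        (\<Sum>S\<in>Pow (?Z c). (-1) ^ card S :: int)"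
      by (rule sum.mono_neutral_cong_right) auto
    also have "\<dots> = of_bool (?Z c = {})" by (rule alternating_sum_Pow) simp
    finally show "(\<Sum>S\<in>Pow (arcs G). (-1) ^ card S * of_bool (S \<subseteq> ?Z c)) =
      (of_bool (?Z c = {}) :: int)" .
  qed
  also have "\<dots> = int (card {c \<in> ?F. ?Z c = {}})"
    using fin by (rule card_filter_eq_sum[symmetric])
  also have "{c \<in> ?F. ?Z c = {}} = nz_flows G b"
    by (auto simp: nz_flows_def flows_def flows_on_def)
  finally show ?thesis .
qed

end

theorem theorem2p3:
  fixes G :: "('v, 'e) pre_digraph" and b :: "'v \<Rightarrow> 'f::field"
  assumes "fin_digraph G" and "b \<in> boundaries G"
  shows
    "((cut_edges_of G b = {} \<longrightarrow>
         arr_char_poly (flows G b) (flow_arr G b) = arr_char_poly (flows G b) (flow_arr_proper G b) \<and>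
         degree (arr_char_poly (flows G b) (flow_arr G b)) = nullity G (arcs G) \<and>
         lead_coeff (arr_char_poly (flows G b) (flow_arr G b)) = 1) \<and>
      (cut_edges_of G b \<noteq> {} \<longrightarrow> arr_char_poly (flows G b) (flow_arr G b) = 0))
     \<and>
     (arr_char_poly (flows G b) (flow_arr G b) = assigning_poly TYPE('f) G (assigning G b) \<and>
      assigning_poly TYPE('f) G (assigning G b) = partition_flow_poly G (partitions_of G b) \<and>
      partition_flow_poly G (partitions_of G ((\<lambda>_. 0) :: 'v \<Rightarrow> 'f)) = flow_poly G)
     \<and>
     (finite (UNIV :: 'f set) \<longrightarrow>
        poly (arr_char_poly (flows G b) (flow_arr G b)) (int (card (UNIV :: 'f set))) =
          int (card (arr_complement (flows G b) (flow_arr G b))) \<and>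
        card (arr_complement (flows G b) (flow_arr G b)) = card (nz_flows G b) \<and>
        int (card (nz_flows G b)) =
          poly (partition_flow_poly G (partitions_of G b)) (int (card (UNIV :: 'f set))))"
proof -
  interpret fin_digraph G by fact
  have "flow_arr_proper G b = flow_arr G b" if "cut_edges_of G b = {}"
    using flows_not_in_flow_arr[OF assms(2) that] by (auto simp: flow_arr_proper_def)
  then show ?thesis
    using char_poly_monic[OF assms(2)] char_poly_vanishes[of b] card_nz_flows[OF _ assms(2)]
    unfolding char_poly_expansion assigning_poly_expansion[OF assms(2)]
      partition_flow_poly_expansion[OF assms(2)] partition_flow_poly_zero arr_complement_flow_arr
    by (intro conjI impI) (simp_all add: char_poly_expansion)
qed

end
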